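(* For $p,q\in\mathbb{N}$ with $1\le q<p$ define \[ N(p,q)=\sum_{j\vdash q-1}\ \sum_{k\vdash p-q}\left(\prod_{i=1}^{q-1} j_i!\,i^{j_i}\prod_{i=1}^{p-q}k_i!\,i^{k_i}\right)^{-1}\prod_{a,b=1}^{p-q}\Bigl(1+\sum_{d\mid \operatorname{lcm}(a,b)} d\,j_d\Bigr)^{k_ak_b\gcd(a,b)}. \] Then for every $n\in\mathbb{N}$, the number of nilpotent semigroups of degree $3$ of order $n$ up to isomorphism equals \[ \sum_{m=2}^{a(n)}\bigl(N(n,m)-N(n-1,m-1)\bigr),\qquad a(n)=\left\lfloor n+\tfrac12-\sqrt{n-\tfrac34}\,\right\rfloor. \]
   Context: A semigroup $S$ is nilpotent of degree $3$ if, writing $S^r=\{s_1\cdots s_r: s_i\in S\}$, we have $|S^3|=1$ and $|S^2|>1$. For $n\ge 0$, $j\vdash n$ means $j$ is a partition of $n$ (the empty partition if $n=0$), and $j_i$ denotes the number of parts of $j$ equal to $i$ (so $j_i=0$ for $i>n$). Sums over $d\mid t$ range over positive divisors $d$ of $t$. *)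

theory Defs
  imports Complex_Main "HOL-Library.Multiset"
begin

text \<open>A partition j of n is a multiset of positive naturals summing to n;
  j_i is then count j i (which is 0 for i > n).\<close>

definition partitions_of :: "nat \<Rightarrow> nat multiset set" where
  "partitions_of n = {M. 0 \<notin># M \<and> sum_mset M = n}"

definition NN :: "nat \<Rightarrow> nat \<Rightarrow> real" where
  "NN p q =
    (\<Sum>j\<in>partitions_of (q - 1). \<Sum>k\<in>partitions_of (p - q).
       inverse ((\<Prod>i\<in>{1..q - 1}. real (fact (count j i)) * real i ^ count j i) *
                (\<Prod>i\<in>{1..p - q}. real (fact (count k i)) * real i ^ count k i)) *
       (\<Prod>a\<in>{1..p - q}. \<Prod>b\<in>{1..p - q}.
          (1 + real (\<Sum>d\<in>{d. 0 < d \<and> d dvd lcm a b}. d * count j d))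
            ^ (count k a * count k b * gcd a b)))"

definition semigroup_tables :: "nat \<Rightarrow> (nat \<Rightarrow> nat \<Rightarrow> nat) set" where
  "semigroup_tables n = {f.
      (\<forall>x<n. \<forall>y<n. f x y < n) \<and>
      (\<forall>x y. \<not> (x < n \<and> y < n) \<longrightarrow> f x y = 0) \<and>
      (\<forall>x<n. \<forall>y<n. \<forall>z<n. f (f x y) z = f x (f y z))}"

text \<open>S^r = set of all products s_1 ... s_r (left-bracketed; by associativity
  the bracketing is irrelevant).\<close>

fun sg_pow :: "(nat \<Rightarrow> nat \<Rightarrow> nat) \<Rightarrow> nat set \<Rightarrow> nat \<Rightarrow> nat set" where
  "sg_pow f S 0 = {}"
| "sg_pow f S (Suc 0) = S"
| "sg_pow f S (Suc (Suc r)) = {f x s | x s. x \<in> sg_pow f S (Suc r) \<and> s \<in> S}"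

definition nilpotent_deg3 :: "nat \<Rightarrow> (nat \<Rightarrow> nat \<Rightarrow> nat) \<Rightarrow> bool" where
  "nilpotent_deg3 n f \<longleftrightarrow>
     card (sg_pow f {0..<n} 3) = 1 \<and> card (sg_pow f {0..<n} 2) > 1"

definition sg_iso_rel :: "nat \<Rightarrow> ((nat \<Rightarrow> nat \<Rightarrow> nat) \<times> (nat \<Rightarrow> nat \<Rightarrow> nat)) set" where
  "sg_iso_rel n = {(f, g). \<exists>\<sigma>. bij_betw \<sigma> {0..<n} {0..<n} \<and>
       (\<forall>x<n. \<forall>y<n. \<sigma> (f x y) = g (\<sigma> x) (\<sigma> y))}"

definition num_nil3 :: "nat \<Rightarrow> nat" where
  "num_nil3 n = card ({f \<in> semigroup_tables n. nilpotent_deg3 n f} // sg_iso_rel n)"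

end

theory Submission
  imports Defs "HOL-Algebra.Group_Action" "HOL-Combinatorics.Cycles" "HOL-Combinatorics.Orbits"
begin

text \<open>A nilpotent semigroup of degree 3 whose square has \<open>c + 1\<close> elements is the same as a map
  \<open>A \<times> A \<rightarrow> C \<union> {0}\<close> hitting all of \<open>C = S\<^sup>2 - {0}\<close>, where \<open>A = S - S\<^sup>2\<close>; isomorphisms are pairs of
  permutations of \<open>A\<close> and \<open>C\<close>. By Burnside's lemma \<open>N(n, c + 1)\<close> counts the orbits of all such maps,
  surjective or not: the number of maps fixed by a pair of permutations is a product over the cycles
  of the induced permutation of \<open>A \<times> A\<close>, so it depends only on the two cycle types. The orbits of
  maps missing an element of \<open>C\<close> are those counted by \<open>N(n - 1, c)\<close>, and no map hits all of \<open>C\<close> once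
  \<open>c\<close> exceeds \<open>(n - c - 1)\<^sup>2\<close>, i.e. once \<open>m = c + 1\<close> exceeds \<open>a(n)\<close>.\<close>

hide_const (open) Group_Action.orbit

subsection \<open>Permutations of a given cycle type\<close>

text \<open>The shape of \<open>NN\<close> comes from two counts. The weight of a partition is the
  share of the permutations that have it as cycle type; class sizes are found by induction on the
  ground set, inserting one point into a cycle at a time. A table fixed by a pair \<alpha>, \<beta>
  is an equivariant map: on each cycle of pairs, of length \<open>t\<close> say, it is free in one
  value, which the \<open>t\<close>-th power of \<beta> must fix. Such a value is either the zero,
  which is the 1 in the formula, or a point on a cycle of \<beta> whose length divides
  \<open>t\<close>, which is the divisor sum. A cycle of length \<open>a\<close> and one of length
  \<open>b\<close> in \<open>A\<close> produce \<open>gcd a b\<close> cycles of pairs of length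
  \<open>lcm a b\<close>, hence the exponents. Associativity imposes nothing: products lie outside
  \<open>A\<close>, so all triple products vanish. The obstacle is the subtraction, since
  \<open>NN n m\<close> and \<open>NN (n - 1) (m - 1)\<close> count orbits of different groups on
  different sets. Both are first read as numbers of classes of one and the same relation; only then
  can one be subtracted from the other.\<close>

definition cycle_type :: "('a \<Rightarrow> 'a) \<Rightarrow> 'a set \<Rightarrow> nat multiset" where
  "cycle_type p A = image_mset card (mset_set (orbit p ` A))"

text \<open>\<open>orbit p y\<close> is generated from \<open>p y\<close>, so in general it need not
  contain \<open>y\<close>. For a permutation it is the cycle through \<open>y\<close>, and the
  cycles are disjoint.\<close>

lemma orbit_eq_iff_mem:
  assumes "permutation p"
  shows "orbit p x = orbit p y \<longleftrightarrow> x \<in> orbit p y"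
  using permutation_self_in_orbit[OF assms] cyclic_on_orbit'[OF assms]
  by (metis orbit_cyclic_eq3)

lemma card_orbit_pos:
  assumes "permutation p"
  shows "0 < card (orbit p x)"
  by (meson assms card_gt_0_iff finite_orbit orbit_nonempty permutation_self_in_orbit)

text \<open>Both are the length of the list \<open>support p x\<close>, which runs once around the
  cycle. This makes the divisibility facts on \<open>least_power\<close> available for
  orbits.\<close>

lemma card_orbit_eq_least_power:
  assumes "permutation p"
  shows "card (orbit p x) = least_power p x"
proof -
  have "orbit p x = set (support p x)"
    using orbit_altdef_bounded[OF least_power_of_permutation[OF assms]] by auto
  moreover have "card (set (support p x)) = length (support p x)"
    using cycle_of_permutation[OF assms] by (rule distinct_card)
  ultimately show ?thesis by simp
qed

lemma funpow_eq_self_iff_card_orbit_dvd: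
  assumes "permutation p"
  shows "(p ^^ k) x = x \<longleftrightarrow> card (orbit p x) dvd k"
  by (simp add: card_orbit_eq_least_power[OF assms] least_power_dvd[OF assms])

lemma orbits_within:
  assumes "p permutes A" "finite A"
  shows "{x \<in> A. orbit p x = O'} = (if O' \<in> orbit p ` A then O' else {})"
proof -
  note perm = permutes_imp_permutation[OF assms(2,1)]
  have "O' = {x \<in> A. orbit p x = O'}" if O: "O' \<in> orbit p ` A"
  proof -
    from O obtain y where y: "y \<in> A" "O' = orbit p y" by blast
    have "O' \<subseteq> A" using permutes_orbit_subset[OF assms(1) y(1)] y(2) by simp
    then show ?thesis using orbit_eq_iff_mem[OF perm] y(2) by auto
  qed
  then show ?thesis by auto
qed

lemma count_cycle_type:
  assumes "finite A"
  shows "count (cycle_type p A) i = card {O' \<in> orbit p ` A. card O' = i}"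
  unfolding cycle_type_def using assms
  by (subst count_image_mset') (auto simp: count_mset_set' intro!: arg_cong[where f = card])

text \<open>The fibre of \<open>orbit p\<close> over a cycle is the cycle itself
  (\<open>orbits_within\<close>), so a cycle of length l is met l times.\<close>

lemma sum_over_orbits:
  fixes g :: "nat \<Rightarrow> 'b :: comm_semiring_1"
  assumes "p permutes A" "finite A"
  shows "(\<Sum>x\<in>A. g (card (orbit p x))) = (\<Sum>O'\<in>orbit p ` A. of_nat (card O') * g (card O'))"
proof -
  have "(\<Sum>x\<in>A. g (card (orbit p x)))
      = (\<Sum>O'\<in>orbit p ` A. \<Sum>x\<in>{x \<in> A. orbit p x = O'}. g (card (orbit p x)))"
    by (rule sum.image_gen[OF assms(2)])
  also have "\<dots> = (\<Sum>O'\<in>orbit p ` A. of_nat (card O') * g (card O'))"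
  proof (rule sum.cong[OF refl])
    fix O' assume "O' \<in> orbit p ` A"
    then have "card {x \<in> A. orbit p x = O'} = card O'"
      using orbits_within[OF assms] by simp
    moreover have "(\<Sum>x\<in>{x \<in> A. orbit p x = O'}. g (card (orbit p x)))
        = (\<Sum>x\<in>{x \<in> A. orbit p x = O'}. g (card O'))"
      by (rule sum.cong) auto
    ultimately show "(\<Sum>x\<in>{x \<in> A. orbit p x = O'}. g (card (orbit p x))) = of_nat (card O') * g (card O')"
      by simp
  qed
  finally show ?thesis .
qed

text \<open>\<open>sum_over_orbits\<close> for the indicator of length \<open>i\<close>. Later
  counts of cycles mostly go through this count of points.\<close>

lemma count_cycle_type_mult:
  assumes "p permutes A" "finite A"
  shows "card {x \<in> A. card (orbit p x) = i} = i * count (cycle_type p A) i"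
proof -
  have "card {x \<in> A. card (orbit p x) = i} = (\<Sum>x\<in>A. of_bool (card (orbit p x) = i))"
    using assms(2) by (simp add: Int_def)
  also have "\<dots> = (\<Sum>O'\<in>orbit p ` A. of_nat (card O') * of_bool (card O' = i))"
    by (rule sum_over_orbits[OF assms])
  also have "\<dots> = (\<Sum>O'\<in>orbit p ` A. if card O' = i then i else 0)"
    by (rule sum.cong) auto
  also have "\<dots> = i * count (cycle_type p A) i"
    using assms(2) by (simp add: count_cycle_type[OF assms(2)] sum.If_cases Int_def mult.commute)
  finally show ?thesis .
qed

lemma sum_mset_cycle_type:
  assumes "p permutes A" "finite A"
  shows "sum_mset (cycle_type p A) = card A"
proof -
  have "card A = (\<Sum>x\<in>A. 1)" by simp
  also have "\<dots> = (\<Sum>O'\<in>orbit p ` A. card O')"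
    using sum_over_orbits[OF assms, of "\<lambda>_. 1 :: nat"] by simp
  finally show ?thesis by (simp add: cycle_type_def sum_unfold_sum_mset)
qed

lemma cycle_type_in_partitions_of:
  assumes "p permutes A" "finite A"
  shows "cycle_type p A \<in> partitions_of (card A)"
proof -
  have "0 \<notin># cycle_type p A"
    using card_orbit_pos[OF permutes_imp_permutation[OF assms(2,1)]] assms(2)
    unfolding cycle_type_def by (auto simp del: card_0_eq card_eq_0_iff) (metis less_irrefl)
  then show ?thesis using sum_mset_cycle_type[OF assms] by (simp add: partitions_of_def)
qed

lemma cycle_type_insert_fixed:
  assumes "q permutes A" "finite A" "x \<notin> A"
  shows "cycle_type q (insert x A) = add_mset 1 (cycle_type q A)"
proof -
  have x: "orbit q x = {x}"
    using permutes_not_in[OF assms(1,3)] by (simp add: orbit_eq_singleton_iff)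
  have "{x} \<notin> orbit q ` A"
    using permutes_orbit_subset[OF assms(1)] assms(3) by blast
  then show ?thesis using assms(2) by (simp add: cycle_type_def x)
qed

text \<open>Composing with the transposition \<open>(x b)\<close> splices the new point \<open>x\<close> into the
  cycle of \<open>b\<close>, right before \<open>b\<close>.\<close>

lemma cycle_type_insert_transpose:
  assumes q: "q permutes A" and fin: "finite A" and x: "x \<notin> A" and b: "b \<in> A"
  shows "cycle_type (transpose x b \<circ> q) (insert x A)
    = add_mset (Suc (card (orbit q b))) (cycle_type q A - {#card (orbit q b)#})"
proof -
  define p where "p = transpose x b \<circ> q"
  have pperm: "p permutes insert x A"
    unfolding p_def using permutes_imp_permutes_insert[OF q] b
    by (intro permutes_compose permutes_swap_id) auto
  have permq: "permutation q" using permutes_imp_permutation[OF fin q] .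
  have permp: "permutation p" using permutes_imp_permutation[OF _ pperm] fin by simp
  note qsub = permutes_orbit_subset[OF q]
  have px: "p x = b" using permutes_not_in[OF q x] by (simp add: p_def)
  have pz: "p z = (if q z = b then x else q z)" if "z \<in> A" for z
    using that x permutes_in_image[OF q, of z] by (auto simp: p_def transpose_def)
  have bself: "b \<in> orbit q b" by (rule permutation_self_in_orbit[OF permq])
  \<comment> \<open>On \<open>A\<close> the two maps differ only at the preimage of
    \<open>b\<close>, which lies on the cycle of \<open>b\<close>.\<close>
  have away: "orbit p z = orbit q z" if z: "z \<in> A" "z \<notin> orbit q b" for z
  proof (rule orbit_cong[OF permutation_self_in_orbit[OF permq]])
    fix s assume s: "s \<in> orbit q z"
    have "q s \<noteq> b"
    proof
      assume "q s = b"
      then have "b \<in> orbit q z" using s orbit.step by metis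
      then show False using z(2) permq by (metis orbit_eq_iff_mem permutation_self_in_orbit)
    qed
    then show "p s = q s" using s qsub[OF z(1)] pz by auto
  qed
  have near: "orbit p x = insert x (orbit q b)"
  proof
    have "y \<in> insert x (orbit q b)" if "y \<in> orbit p x" for y
      using that
    proof induct
      case base
      then show ?case using px bself by simp
    next
      case (step y)
      then show ?case using px bself pz qsub[OF b] orbit.step by (metis insert_iff subsetD)
    qed
    then show "orbit p x \<subseteq> insert x (orbit q b)" by blast
    have xself: "x \<in> orbit p x" by (rule permutation_self_in_orbit[OF permp])
    have bin: "b \<in> orbit p x" using px orbit.base by metis
    have "y \<in> orbit p x \<and> y \<in> A" if "y \<in> orbit q b" for y
      using that
    proof induct
      case base
      then show ?case using bin b pz[OF b] orbit.step[OF bin] permutes_in_image[OF q, of b]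
        by (auto split: if_splits)
    next
      case (step y)
      then show ?case using bin pz[of y] orbit.step[of y p x] permutes_in_image[OF q, of y]
        by (auto split: if_splits)
    qed
    then show "insert x (orbit q b) \<subseteq> orbit p x" using xself by blast
  qed
  have near': "orbit p z = insert x (orbit q b)" if "z \<in> orbit q b" for z
    using near that orbit_eq_iff_mem[OF permp, of z x] by auto
  define Os where "Os = orbit q ` A"
  \<comment> \<open>The cycle of \<open>b\<close> is exchanged for the one lengthened by
    \<open>x\<close>; all others survive.\<close>
  have "orbit p ` insert x A = insert (insert x (orbit q b)) (Os - {orbit q b})"
  proof -
    have A: "insert x A = insert x (orbit q b) \<union> (A - orbit q b)" using qsub[OF b] by auto
    have "orbit p ` insert x (orbit q b) = {insert x (orbit q b)}"
      using near near' by auto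
    moreover have "orbit p ` (A - orbit q b) = Os - {orbit q b}"
    proof -
      have "orbit p ` (A - orbit q b) = orbit q ` (A - orbit q b)"
        using away by (intro image_cong) auto
      also have "\<dots> = Os - {orbit q b}"
        unfolding Os_def using orbit_eq_iff_mem[OF permq, of _ b] by blast
      finally show ?thesis .
    qed
    ultimately show ?thesis by (subst A) (simp only: image_Un insert_is_Un[symmetric])
  qed
  moreover have "insert x (orbit q b) \<notin> Os"
    using qsub x by (auto simp: Os_def)
  moreover have "finite Os" using fin by (simp add: Os_def)
  moreover have "orbit q b \<in> Os" using b by (simp add: Os_def)
  moreover have "card (insert x (orbit q b)) = Suc (card (orbit q b))"
    using qsub[OF b] x finite_orbit[OF bself] by (subst card_insert_disjoint) auto
  ultimately show ?thesis
    unfolding cycle_type_def p_def[symmetric] Os_def[symmetric]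
    by (simp add: mset_set_Diff image_mset_Diff)
qed

section \<open>Sizes of the conjugacy classes of the symmetric group\<close>

definition centralizer_order :: "nat multiset \<Rightarrow> real" where
  "centralizer_order M = (\<Prod>i\<in>set_mset M. fact (count M i) * real i ^ count M i)"

text \<open>An \<open>i\<close> that is not a part contributes \<open>fact 0 * real i ^ 0\<close>,
  which is 1. So the product over the support agrees with the one over \<open>{1..n}\<close> in
  \<open>NN\<close>.\<close>

lemma centralizer_order_superset:
  assumes "finite S" "set_mset M \<subseteq> S"
  shows "centralizer_order M = (\<Prod>i\<in>S. fact (count M i) * real i ^ count M i)"
  unfolding centralizer_order_def
  by (rule prod.mono_neutral_left) (use assms in \<open>auto simp: not_in_iff\<close>)

lemma centralizer_order_add_mset:
  "centralizer_order (add_mset i M) = real i * real (Suc (count M i)) * centralizer_order M"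
proof -
  let ?S = "insert i (set_mset M)" and ?w = "\<lambda>M i. fact (count M i) * real i ^ count M i"
  have "centralizer_order (add_mset i M) = ?w (add_mset i M) i * (\<Prod>k\<in>set_mset M - {i}. ?w (add_mset i M) k)"
    using centralizer_order_superset[of ?S "add_mset i M"] by (simp add: prod.insert_remove)
  also have "(\<Prod>k\<in>set_mset M - {i}. ?w (add_mset i M) k) = (\<Prod>k\<in>set_mset M - {i}. ?w M k)"
    by (rule prod.cong) auto
  also have "?w (add_mset i M) i * \<dots> = real i * real (Suc (count M i)) * (?w M i * (\<Prod>k\<in>set_mset M - {i}. ?w M k))"
    by (simp add: algebra_simps)
  also have "?w M i * (\<Prod>k\<in>set_mset M - {i}. ?w M k) = centralizer_order M"
    using centralizer_order_superset[of ?S M, OF _ subset_insertI] by (simp add: prod.insert_remove)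
  finally show ?thesis .
qed

lemma centralizer_order_pos:
  assumes "0 \<notin># M"
  shows "0 < centralizer_order M"
  unfolding centralizer_order_def
  by (rule prod_pos) (use assms in \<open>auto intro!: mult_pos_pos zero_less_power gr0I\<close>)

lemma set_mset_partition_subset:
  assumes "M \<in> partitions_of n"
  shows "set_mset M \<subseteq> {1..n}"
proof
  fix i assume i: "i \<in># M"
  then have "i \<le> sum_mset M" by (metis le_add1 multi_member_split sum_mset.add_mset)
  then show "i \<in> {1..n}" using assms i by (cases i) (auto simp: partitions_of_def)
qed

lemma sum_mset_eq_sum_count:
  fixes M :: "nat multiset"
  assumes "finite S" "set_mset M \<subseteq> S"
  shows "sum_mset M = (\<Sum>i\<in>S. i * count M i)"
  using assms(2)
proof (induct M)
  case (add x M)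
  then have x: "x \<in> S" by simp
  have "(\<Sum>i\<in>S. i * count (add_mset x M) i) = (\<Sum>i\<in>S. i * count M i + (if i = x then x else 0))"
    by (rule sum.cong) auto
  also have "\<dots> = (\<Sum>i\<in>S. i * count M i) + x"
    using x assms(1) by (simp add: sum.distrib)
  finally show ?case using add by simp
qed simp

text \<open>Every permutation of \<open>insert x A\<close> is uniquely
  \<open>transpose x b \<circ> q\<close> with \<open>q\<close> permuting \<open>A\<close>. For
  \<open>b = x\<close> the new point is fixed; for \<open>b\<close> on an l-cycle of
  \<open>q\<close> that cycle grows to length l + 1, and \<open>q\<close> offers l times its number
  of l-cycles such \<open>b\<close>. The resulting recursion is solved by n! over the centralizer
  order because the parts of \<open>M\<close> sum to n.\<close>

theorem card_permutations_of_cycle_type: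
  assumes "finite A" "M \<in> partitions_of (card A)"
  shows "real (card {p. p permutes A \<and> cycle_type p A = M}) = fact (card A) / centralizer_order M"
  using assms
proof (induct A arbitrary: M rule: finite_induct)
  case empty
  have M: "M = {#}" using set_mset_partition_subset[OF empty] by simp
  show ?case by (simp add: M cycle_type_def centralizer_order_def)
next
  case (insert x A M)
  let ?n = "card A"
  let ?P = "{q. q permutes A}"
  \<comment> \<open>The type that \<open>q\<close> must have for an insertion into an l-cycle to
    yield \<open>M\<close>. Multiset difference truncates, so each use is guarded by
    \<open>Suc l \<in># M\<close>.\<close>
  let ?Q = "\<lambda>l. add_mset l (M - {#Suc l#})"
  have finP: "finite ?P" using finite_permutations[OF insert(1)] .
  have part: "sum_mset M = Suc ?n" "0 \<notin># M"
    using insert(1,2,4) by (auto simp: partitions_of_def)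
  have Msub: "set_mset M \<subseteq> {1..Suc ?n}"
    using set_mset_partition_subset[OF insert(4)] insert(1,2) by simp
  have IH: "real (card {q \<in> ?P. cycle_type q A = N}) * centralizer_order N = fact ?n"
    if "sum_mset N = ?n" "0 \<notin># N" for N
    using insert(3)[of N] that centralizer_order_pos[OF that(2)] by (simp add: partitions_of_def)
  have inner: "(\<Sum>b\<in>A. of_bool (cycle_type (transpose x b \<circ> q) (insert x A) = M) :: real)
     = (\<Sum>l\<in>{1..?n}. of_bool (Suc l \<in># M \<and> cycle_type q A = ?Q l) * (real l * real (count (?Q l) l)))"
    if q: "q permutes A" for q
  proof -
    let ?C = "cycle_type q A"
    have mem: "card (orbit q b) \<in> {1..?n}" if "b \<in> A" for b
    proof -
      have "card (orbit q b) \<in># cycle_type q A"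
        using that insert(1) by (simp add: cycle_type_def)
      then show ?thesis
        using set_mset_partition_subset[OF cycle_type_in_partitions_of[OF q insert(1)]] by blast
    qed
    have "(\<Sum>b\<in>A. of_bool (cycle_type (transpose x b \<circ> q) (insert x A) = M))
        = (\<Sum>b\<in>A. of_bool (add_mset (Suc (card (orbit q b))) (?C - {#card (orbit q b)#}) = M) :: real)"
      using cycle_type_insert_transpose[OF q insert(1,2)] by (intro sum.cong) auto
    also have "\<dots> = (\<Sum>l\<in>{1..?n}. \<Sum>b\<in>{b \<in> A. card (orbit q b) = l}.
        of_bool (add_mset (Suc (card (orbit q b))) (?C - {#card (orbit q b)#}) = M))"
      by (rule sum.group[symmetric]) (use insert(1) mem in auto)
    also have "\<dots> = (\<Sum>l\<in>{1..?n}. of_bool (add_mset (Suc l) (?C - {#l#}) = M) * (real l * real (count ?C l)))"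
    proof (rule sum.cong[OF refl])
      fix l
      have "(\<Sum>b\<in>{b \<in> A. card (orbit q b) = l}.
          of_bool (add_mset (Suc (card (orbit q b))) (?C - {#card (orbit q b)#}) = M))
        = (\<Sum>b\<in>{b \<in> A. card (orbit q b) = l}. of_bool (add_mset (Suc l) (?C - {#l#}) = M) :: real)"
        by (rule sum.cong) auto
      then show "(\<Sum>b\<in>{b \<in> A. card (orbit q b) = l}.
          of_bool (add_mset (Suc (card (orbit q b))) (?C - {#card (orbit q b)#}) = M))
        = of_bool (add_mset (Suc l) (?C - {#l#}) = M) * (real l * real (count ?C l))"
        using count_cycle_type_mult[OF q insert(1), of l] by simp
    qed
    \<comment> \<open>The condition is solved for the type of \<open>q\<close>. If \<open>l\<close>
      is not a part of that type, the left side vanishes through its count and the right side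
      through its guard, as \<open>?Q l\<close> contains \<open>l\<close>.\<close>
    also have "\<dots> = (\<Sum>l\<in>{1..?n}. of_bool (Suc l \<in># M \<and> ?C = ?Q l) * (real l * real (count (?Q l) l)))"
    proof (rule sum.cong[OF refl])
      fix l
      have "Suc l \<in># M \<and> ?C = ?Q l \<longleftrightarrow> l \<in># ?C \<and> add_mset (Suc l) (?C - {#l#}) = M"
        by auto
      then show "of_bool (add_mset (Suc l) (?C - {#l#}) = M) * (real l * real (count ?C l))
          = of_bool (Suc l \<in># M \<and> ?C = ?Q l) * (real l * real (count (?Q l) l))"
        by (cases "l \<in># ?C") (auto simp: not_in_iff)
    qed
    finally show ?thesis .
  qed
  have "{p. p permutes insert x A \<and> cycle_type p (insert x A) = M}
      = {p. p permutes insert x A} \<inter> {p. cycle_type p (insert x A) = M}" by auto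
  then have "real (card {p. p permutes insert x A \<and> cycle_type p (insert x A) = M})
      = (\<Sum>p | p permutes insert x A. of_bool (cycle_type p (insert x A) = M))"
    using finite_permutations[of "insert x A"] insert(1) by simp
  also have "\<dots> = (\<Sum>b\<in>insert x A. \<Sum>q\<in>?P. of_bool (cycle_type (transpose x b \<circ> q) (insert x A) = M))"
    by (rule sum_over_permutations_insert[OF insert(1,2)])
  also have "\<dots> = (\<Sum>q\<in>?P. of_bool (cycle_type q (insert x A) = M))
      + (\<Sum>q\<in>?P. \<Sum>b\<in>A. of_bool (cycle_type (transpose x b \<circ> q) (insert x A) = M))"
    by (simp only: sum.insert[OF insert(1,2)] transpose_same id_comp id_o sum.swap[of _ ?P A])
  also have "(\<Sum>q\<in>?P. of_bool (cycle_type q (insert x A) = M))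
      = (\<Sum>q\<in>?P. of_bool (1 \<in># M \<and> cycle_type q A = M - {#1#}) :: real)"
  proof (rule sum.cong[OF refl])
    fix q assume "q \<in> ?P"
    then show "of_bool (cycle_type q (insert x A) = M) = (of_bool (1 \<in># M \<and> cycle_type q A = M - {#1#}) :: real)"
      using cycle_type_insert_fixed[OF _ insert(1,2)] by auto
  qed
  also have "\<dots> = of_bool (1 \<in># M) * real (card {q \<in> ?P. cycle_type q A = M - {#1#}})"
    using finP by (cases "1 \<in># M") (simp_all add: Int_def)
  also have "(\<Sum>q\<in>?P. \<Sum>b\<in>A. of_bool (cycle_type (transpose x b \<circ> q) (insert x A) = M))
     = (\<Sum>q\<in>?P. \<Sum>l\<in>{1..?n}. of_bool (Suc l \<in># M \<and> cycle_type q A = ?Q l) * (real l * real (count (?Q l) l)))"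
    using inner by (intro sum.cong) auto
  also have "\<dots> = (\<Sum>l\<in>{1..?n}. \<Sum>q\<in>?P. of_bool (Suc l \<in># M \<and> cycle_type q A = ?Q l) * (real l * real (count (?Q l) l)))"
    by (rule sum.swap)
  also have "\<dots> = (\<Sum>l\<in>{1..?n}. of_bool (Suc l \<in># M) * (real (card {q \<in> ?P. cycle_type q A = ?Q l}) * (real l * real (count (?Q l) l))))"
  proof (rule sum.cong[OF refl])
    fix l
    show "(\<Sum>q\<in>?P. of_bool (Suc l \<in># M \<and> cycle_type q A = ?Q l) * (real l * real (count (?Q l) l)))
      = of_bool (Suc l \<in># M) * (real (card {q \<in> ?P. cycle_type q A = ?Q l}) * (real l * real (count (?Q l) l)))"
      using finP by (cases "Suc l \<in># M") (simp_all add: Int_def flip: sum_distrib_right)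
  qed
  finally have total: "real (card {p. p permutes insert x A \<and> cycle_type p (insert x A) = M})
    = of_bool (1 \<in># M) * real (card {q \<in> ?P. cycle_type q A = M - {#1#}})
      + (\<Sum>l\<in>{1..?n}. of_bool (Suc l \<in># M) * (real (card {q \<in> ?P. cycle_type q A = ?Q l}) * (real l * real (count (?Q l) l))))" .
  \<comment> \<open>After multiplication by \<open>centralizer_order M\<close>, the number of
    insertion points cancels against the same factor in \<open>centralizer_order (?Q l)\<close>.
    What remains is \<open>fact ?n\<close> times i times the multiplicity of i, with i = 1 here and
    i = \<open>Suc l\<close> in \<open>spliced\<close>; these sum to
    \<open>fact ?n * Suc ?n\<close>.\<close>
  have fixed: "of_bool (1 \<in># M) * real (card {q \<in> ?P. cycle_type q A = M - {#1#}}) * centralizer_order M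
      = fact ?n * (real 1 * real (count M 1))"
  proof (cases "1 \<in># M")
    case True
    then obtain N where N: "M = add_mset 1 N" by (metis insert_DiffM)
    have "real (card {q \<in> ?P. cycle_type q A = N}) * centralizer_order N = fact ?n"
      using part N by (intro IH) auto
    then show ?thesis by (simp add: N centralizer_order_add_mset algebra_simps)
  qed (simp add: not_in_iff)
  have spliced: "of_bool (Suc l \<in># M) * (real (card {q \<in> ?P. cycle_type q A = ?Q l}) * (real l * real (count (?Q l) l))) * centralizer_order M
      = fact ?n * (real (Suc l) * real (count M (Suc l)))" if l: "1 \<le> l" for l
  proof (cases "Suc l \<in># M")
    case True
    then obtain N where N: "M = add_mset (Suc l) N" by (metis insert_DiffM)
    have "real (card {q \<in> ?P. cycle_type q A = add_mset l N}) * centralizer_order (add_mset l N) = fact ?n"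
      using part N l by (intro IH) auto
    then have "real (card {q \<in> ?P. cycle_type q A = add_mset l N}) * (real l * real (Suc (count N l)) * centralizer_order N) = fact ?n"
      by (simp only: centralizer_order_add_mset)
    then have "real (card {q \<in> ?P. cycle_type q A = add_mset l N}) * (real l * real (Suc (count N l)) * centralizer_order N)
        * (real (Suc l) * real (Suc (count N (Suc l)))) = fact ?n * (real (Suc l) * real (Suc (count N (Suc l))))"
      by (simp only:)
    then show ?thesis
      by (simp only: N centralizer_order_add_mset) (simp add: mult_ac)
  qed (simp add: not_in_iff)
  have "real (card {p. p permutes insert x A \<and> cycle_type p (insert x A) = M}) * centralizer_order M
    = fact ?n * (real 1 * real (count M 1)) + (\<Sum>l\<in>{1..?n}. fact ?n * (real (Suc l) * real (count M (Suc l))))"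
    unfolding total distrib_right fixed sum_distrib_right by (intro arg_cong2[where f = "(+)"] refl sum.cong spliced) auto
  also have "\<dots> = fact ?n * real (1 * count M 1 + (\<Sum>l\<in>{1..?n}. Suc l * count M (Suc l)))"
    by (simp add: sum_distrib_left algebra_simps)
  also have "1 * count M 1 + (\<Sum>l\<in>{1..?n}. Suc l * count M (Suc l)) = (\<Sum>l\<in>{1..Suc ?n}. l * count M l)"
    using sum.atLeast_Suc_atMost[of 1 "Suc ?n" "\<lambda>l. l * count M l"]
      sum.shift_bounds_cl_Suc_ivl[of "\<lambda>l. l * count M l" 1 ?n]
    by (simp del: mult_Suc sum.cl_ivl_Suc)
  also have "\<dots> = Suc ?n" using sum_mset_eq_sum_count[OF _ Msub] part by simp
  finally show ?case
    using centralizer_order_pos[OF part(2)] insert(1,2) by (simp add: field_simps)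
qed

subsection \<open>Fixed points and equivariant functions\<close>

lemma funpow_cong_mod:
  assumes "(f ^^ l) y = y" "m mod l = n mod l"
  shows "(f ^^ m) y = (f ^^ n) y"
  by (metis assms funpow_mod_eq)

text \<open>Cancelling the smaller power, which is injective, leaves a power that fixes
  \<open>x\<close>.\<close>

lemma funpow_eq_imp_mod_card_orbit:
  assumes p: "permutation p" and eq: "(p ^^ m) x = (p ^^ n) x"
  shows "m mod card (orbit p x) = n mod card (orbit p x)"
proof -
  have *: "m mod card (orbit p x) = n mod card (orbit p x)"
    if "m \<le> n" "(p ^^ m) x = (p ^^ n) x" for m n
  proof -
    have "(p ^^ m) ((p ^^ (n - m)) x) = (p ^^ m) x"
      using that by (metis funpow_add le_add_diff_inverse o_apply)
    moreover have "inj (p ^^ m)"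
      using p by (metis bij_is_inj inj_fn permutation)
    ultimately have "(p ^^ (n - m)) x = x" by (simp add: inj_eq)
    then have "card (orbit p x) dvd n - m"
      using funpow_eq_self_iff_card_orbit_dvd[OF p] by blast
    then show ?thesis using that(1) by (metis mod_eq_dvd_iff_nat)
  qed
  show ?thesis
    using *[of m n] *[of n m] eq by (metis nat_le_linear)
qed

lemma equivariant_funpow:
  assumes "p permutes X" "\<And>x. x \<in> X \<Longrightarrow> h (p x) = f (h x)" "x \<in> X"
  shows "h ((p ^^ k) x) = (f ^^ k) (h x)"
  by (induct k) (use assms permutes_in_funpow_image[OF assms(1,3)] in auto)

text \<open>An equivariant function is determined by its values at one representative of each orbit,
  and these values are constrained only by the orbit lengths.\<close>

lemma card_equivariant_functions:
  assumes p: "p permutes X" and fin: "finite X" and f: "f ` Y \<subseteq> Y"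
  shows "card {h \<in> X \<rightarrow>\<^sub>E Y. \<forall>x\<in>X. h (p x) = f (h x)}
    = (\<Prod>O'\<in>orbit p ` X. card {y \<in> Y. (f ^^ card O') y = y})"
proof -
  define H where "H = {h \<in> X \<rightarrow>\<^sub>E Y. \<forall>x\<in>X. h (p x) = f (h x)}"
  define Os where "Os = orbit p ` X"
  \<comment> \<open>The admissible values at a representative: going once around the cycle must
    return to the same value.\<close>
  define Z where "Z O' = {y \<in> Y. (f ^^ card O') y = y}" for O' :: "'a set"
  define rep where "rep O' = (SOME r. r \<in> X \<and> orbit p r = O')" for O'
  note perm = permutes_imp_permutation[OF fin p]
  have rep: "rep O' \<in> X" "orbit p (rep O') = O'" if "O' \<in> Os" for O'
  proof -
    have "\<exists>r. r \<in> X \<and> orbit p r = O'" using that unfolding Os_def by blast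
    from someI_ex[OF this] show "rep O' \<in> X" "orbit p (rep O') = O'"
      unfolding rep_def by auto
  qed
  \<comment> \<open>An arbitrary exponent leading from the representative to \<open>x\<close>; only
    its residue modulo the cycle length matters.\<close>
  define k where "k x = (SOME k. (p ^^ k) (rep (orbit p x)) = x)" for x
  have k: "(p ^^ k x) (rep (orbit p x)) = x" if "x \<in> X" for x
  proof -
    have "x \<in> orbit p (rep (orbit p x))"
      using that rep[of "orbit p x"] permutation_self_in_orbit[OF perm] by (simp add: Os_def)
    then obtain n where "x = (p ^^ n) (rep (orbit p x))"
      unfolding orbit_altdef[of p "rep (orbit p x)"] by blast
    then have "\<exists>k. (p ^^ k) (rep (orbit p x)) = x" by metis
    from someI_ex[OF this] show ?thesis unfolding k_def .
  qed
  have funpow_Y: "(f ^^ n) y \<in> Y" if "y \<in> Y" for n y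
    by (induct n) (use that f in auto)
  have eqv: "h ((p ^^ n) x) = (f ^^ n) (h x)" if "h \<in> H" "x \<in> X" for h x n
    by (rule equivariant_funpow[OF p]) (use that H_def in auto)
  have "bij_betw (\<lambda>h. \<lambda>O'\<in>Os. h (rep O')) H (Pi\<^sub>E Os Z)"
  proof (rule bij_betw_imageI)
    show "inj_on (\<lambda>h. \<lambda>O'\<in>Os. h (rep O')) H"
    proof (rule inj_onI)
      fix h h' assume h: "h \<in> H" and h': "h' \<in> H"
        and eq: "(\<lambda>O'\<in>Os. h (rep O')) = (\<lambda>O'\<in>Os. h' (rep O'))"
      have "h x = h' x" if x: "x \<in> X" for x
      proof -
        have O: "orbit p x \<in> Os" using x by (simp add: Os_def)
        then have "h (rep (orbit p x)) = h' (rep (orbit p x))"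
          using fun_cong[OF eq, of "orbit p x"] by simp
        then show ?thesis
          using eqv[OF h rep(1)[OF O], of "k x"] eqv[OF h' rep(1)[OF O], of "k x"] k[OF x] by simp
      qed
      moreover have "h \<in> extensional X" "h' \<in> extensional X"
        using h h' by (auto simp: H_def PiE_def)
      ultimately show "h = h'" by (metis extensionalityI)
    qed
    show "(\<lambda>h. \<lambda>O'\<in>Os. h (rep O')) ` H = Pi\<^sub>E Os Z"
    proof
      show "(\<lambda>h. \<lambda>O'\<in>Os. h (rep O')) ` H \<subseteq> Pi\<^sub>E Os Z"
      proof clarify
        fix h assume h: "h \<in> H"
        have "h (rep O') \<in> Z O'" if O: "O' \<in> Os" for O'
        proof -
          have "(p ^^ card O') (rep O') = rep O'"
            using funpow_eq_self_iff_card_orbit_dvd[OF perm, of "card O'" "rep O'"] rep[OF O] by simp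
          then show ?thesis
            using eqv[OF h rep(1)[OF O], of "card O'"] h rep(1)[OF O] by (auto simp: Z_def H_def)
        qed
        then show "(\<lambda>O'\<in>Os. h (rep O')) \<in> Pi\<^sub>E Os Z" by auto
      qed
      show "Pi\<^sub>E Os Z \<subseteq> (\<lambda>h. \<lambda>O'\<in>Os. h (rep O')) ` H"
      proof
        fix g assume g: "g \<in> Pi\<^sub>E Os Z"
        define h where "h = (\<lambda>x\<in>X. (f ^^ k x) (g (orbit p x)))"
        have gZ: "g (orbit p x) \<in> Y" "(f ^^ card (orbit p x)) (g (orbit p x)) = g (orbit p x)"
          if "x \<in> X" for x
          using g that by (auto simp: Os_def Z_def)
        \<comment> \<open>Independence of the chosen exponent. Equivariance then follows with
          exponent \<open>Suc (k x)\<close> at \<open>p x\<close>, and \<open>h\<close> extends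
          \<open>g\<close> by exponent 0 at the representatives.\<close>
        have h_eq: "h x = (f ^^ n) (g (orbit p x))" if x: "x \<in> X" and n: "(p ^^ n) (rep (orbit p x)) = x" for x n
        proof -
          have "orbit p (rep (orbit p x)) = orbit p x" using rep x by (simp add: Os_def)
          then have "k x mod card (orbit p x) = n mod card (orbit p x)"
            using funpow_eq_imp_mod_card_orbit[OF perm, of "k x" "rep (orbit p x)" n] k[OF x] n by simp
          then have "(f ^^ k x) (g (orbit p x)) = (f ^^ n) (g (orbit p x))"
            by (rule funpow_cong_mod[OF gZ(2)[OF x]])
          then show ?thesis using x by (simp add: h_def)
        qed
        have "h (p x) = f (h x)" if x: "x \<in> X" for x
        proof -
          have px: "p x \<in> X" "orbit p (p x) = orbit p x"
            using x permutes_in_image[OF p] permutation_orbit_step[OF perm] by auto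
          have "h (p x) = (f ^^ Suc (k x)) (g (orbit p (p x)))"
            by (rule h_eq[OF px(1)]) (simp add: px(2) k[OF x])
          then show ?thesis using x px by (simp add: h_def)
        qed
        moreover have "h \<in> X \<rightarrow>\<^sub>E Y" using gZ(1) funpow_Y by (auto simp: h_def)
        ultimately have "h \<in> H" by (simp add: H_def)
        moreover have "g = (\<lambda>O'\<in>Os. h (rep O'))"
        proof
          fix O'
          show "g O' = (\<lambda>O'\<in>Os. h (rep O')) O'"
          proof (cases "O' \<in> Os")
            case True
            then show ?thesis using h_eq[of "rep O'" 0] rep[OF True] by simp
          next
            case False
            then show ?thesis using g by (auto simp: PiE_def extensional_def)
          qed
        qed
        ultimately show "g \<in> (\<lambda>h. \<lambda>O'\<in>Os. h (rep O')) ` H" by blast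
      qed
    qed
  qed
  then have "card H = card (Pi\<^sub>E Os Z)" by (rule bij_betw_same_card)
  also have "\<dots> = (\<Prod>O'\<in>Os. card (Z O'))" by (rule card_PiE) (simp add: Os_def fin)
  finally show ?thesis by (simp add: H_def Os_def Z_def)
qed

text \<open>Cycles are grouped by length. \<open>S\<close> may contain lengths that do not occur, as
  these contribute a zeroth power.\<close>

lemma prod_over_orbits:
  assumes fin: "finite A" "finite S" and sub: "card ` orbit p ` A \<subseteq> S"
  shows "(\<Prod>O'\<in>orbit p ` A. F (card O')) = (\<Prod>i\<in>S. F i ^ count (cycle_type p A) i)"
proof -
  have "(\<Prod>O'\<in>orbit p ` A. F (card O'))
      = (\<Prod>i\<in>S. \<Prod>O'\<in>{O' \<in> orbit p ` A. card O' = i}. F (card O'))"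
    by (rule prod.group[symmetric]) (use assms in auto)
  also have "\<dots> = (\<Prod>i\<in>S. F i ^ count (cycle_type p A) i)"
  proof (rule prod.cong[OF refl])
    fix i
    have "(\<Prod>O'\<in>{O' \<in> orbit p ` A. card O' = i}. F (card O')) = (\<Prod>O'\<in>{O' \<in> orbit p ` A. card O' = i}. F i)"
      by (rule prod.cong) auto
    then show "(\<Prod>O'\<in>{O' \<in> orbit p ` A. card O' = i}. F (card O')) = F i ^ count (cycle_type p A) i"
      by (simp add: count_cycle_type[OF fin(1)])
  qed
  finally show ?thesis .
qed

text \<open>A point is fixed exactly when its cycle length d divides \<open>t\<close>, and cycles of
  length d hold d times their number of points. This is the divisor sum in \<open>NN\<close>;
  \<open>0 < t\<close> keeps the set of divisors finite.\<close>

lemma card_funpow_fixed_points: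
  assumes p: "p permutes C" and fin: "finite C" and t: "0 < t"
  shows "card {y \<in> C. (p ^^ t) y = y} = (\<Sum>d | 0 < d \<and> d dvd t. d * count (cycle_type p C) d)"
proof -
  note perm = permutes_imp_permutation[OF fin p]
  have "card {y \<in> C. (p ^^ t) y = y} = (\<Sum>y\<in>{y \<in> C. card (orbit p y) dvd t}. 1)"
    by (simp add: funpow_eq_self_iff_card_orbit_dvd[OF perm])
  also have "\<dots> = (\<Sum>d\<in>{d. 0 < d \<and> d dvd t}. \<Sum>y\<in>{y \<in> {y \<in> C. card (orbit p y) dvd t}. card (orbit p y) = d}. 1)"
    by (rule sum.group[symmetric]) (use fin t card_orbit_pos[OF perm] in auto)
  also have "\<dots> = (\<Sum>d | 0 < d \<and> d dvd t. d * count (cycle_type p C) d)"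
  proof (rule sum.cong[OF refl])
    fix d assume "d \<in> {d. 0 < d \<and> d dvd t}"
    then have "{y \<in> {y \<in> C. card (orbit p y) dvd t}. card (orbit p y) = d} = {y \<in> C. card (orbit p y) = d}"
      by auto
    then show "(\<Sum>y\<in>{y \<in> {y \<in> C. card (orbit p y) dvd t}. card (orbit p y) = d}. 1) = d * count (cycle_type p C) d"
      using count_cycle_type_mult[OF p fin] by simp
  qed
  finally show ?thesis .
qed

section \<open>Cycles of a permutation acting on pairs\<close>

text \<open>\<open>map_prod p p\<close> also moves pairs with just one coordinate in
  \<open>A\<close>; the restriction yields a map that permutes the square and nothing else.\<close>

definition square_perm :: "'a set \<Rightarrow> ('a \<Rightarrow> 'a) \<Rightarrow> 'a \<times> 'a \<Rightarrow> 'a \<times> 'a" where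
  "square_perm A p = restrict_id (map_prod p p) (A \<times> A)"

lemma square_perm_permutes:
  assumes "p permutes A"
  shows "square_perm A p permutes A \<times> A"
  unfolding square_perm_def
  by (intro permutes_restrict_id bij_betw_map_prod permutes_imp_bij assms)

lemma square_perm_apply: "x \<in> A \<Longrightarrow> y \<in> A \<Longrightarrow> square_perm A p (x, y) = (p x, p y)"
  by (simp add: square_perm_def restrict_id_def)

text \<open>A pair returns after \<open>k\<close> steps exactly when both coordinates do, so the two
  sides have the same multiples.\<close>

lemma card_orbit_square_perm:
  assumes p: "p permutes A" and fin: "finite A" and xy: "x \<in> A" "y \<in> A"
  shows "card (orbit (square_perm A p) (x, y)) = lcm (card (orbit p x)) (card (orbit p y))"
proof -
  note perm = permutes_imp_permutation[OF fin p]
  have perm2: "permutation (square_perm A p)"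
    using permutes_imp_permutation[OF _ square_perm_permutes[OF p]] fin by simp
  have pow: "(square_perm A p ^^ k) (x, y) = ((p ^^ k) x, (p ^^ k) y)" for k
    by (induct k) (use permutes_in_funpow_image[OF p] xy in \<open>auto simp: square_perm_apply\<close>)
  have "card (orbit (square_perm A p) (x, y)) dvd k \<longleftrightarrow> lcm (card (orbit p x)) (card (orbit p y)) dvd k" for k
    unfolding funpow_eq_self_iff_card_orbit_dvd[OF perm2, symmetric] pow
    by (simp add: funpow_eq_self_iff_card_orbit_dvd[OF perm])
  then show ?thesis by (meson dvd_antisym dvd_refl)
qed

text \<open>The product of an a-cycle and a b-cycle has a b points, all on cycles of length
  \<open>lcm a b\<close>, hence \<open>gcd a b\<close> cycles.\<close>

lemma prod_orbits_square_perm: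
  fixes F :: "nat \<Rightarrow> real"
  assumes p: "p permutes A" and fin: "finite A" and n: "n = card A"
  shows "(\<Prod>O'\<in>orbit (square_perm A p) ` (A \<times> A). F (card O'))
    = (\<Prod>a\<in>{1..n}. \<Prod>b\<in>{1..n}. F (lcm a b)
        ^ (count (cycle_type p A) a * count (cycle_type p A) b * gcd a b))"
proof -
  let ?k = "count (cycle_type p A)" and ?sq = "square_perm A p"
  let ?N = "{1..n} \<times> {1..n}"
  let ?S = "(\<lambda>(a, b). lcm a b) ` ?N"
  have fin2: "finite (A \<times> A)" using fin by simp
  have mem: "card (orbit p x) \<in> {1..n}" if "x \<in> A" for x
  proof -
    have "card (orbit p x) \<in># cycle_type p A"
      using that fin by (simp add: cycle_type_def)
    then show ?thesis
      using set_mset_partition_subset[OF cycle_type_in_partitions_of[OF p fin]] n by blast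
  qed
  \<comment> \<open>Points on cycles of length \<open>i\<close> are counted by the lengths of their
    two coordinates; \<open>a * b = lcm a b * gcd a b\<close> brings out the factor
    \<open>i\<close>, which is cancelled at the end.\<close>
  have count: "count (cycle_type ?sq (A \<times> A)) i = (\<Sum>(a, b)\<in>{c \<in> ?N. (\<lambda>(a, b). lcm a b) c = i}. ?k a * ?k b * gcd a b)"
    if "i \<in> ?S" for i
  proof -
    have i: "0 < i" using that by (auto intro!: lcm_pos_nat)
    let ?g = "\<lambda>(x, y). (card (orbit p x), card (orbit p y))"
    let ?L = "{c \<in> ?N. (\<lambda>(a, b). lcm a b) c = i}"
    let ?T = "{z \<in> A \<times> A. card (orbit ?sq z) = i}"
    have "i * count (cycle_type ?sq (A \<times> A)) i = (\<Sum>z\<in>?T. 1)"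
      using count_cycle_type_mult[OF square_perm_permutes[OF p] fin2] by simp
    also have "\<dots> = (\<Sum>c\<in>?L. \<Sum>z\<in>{z \<in> ?T. ?g z = c}. 1)"
      by (rule sum.group[symmetric]) (use fin mem in \<open>auto simp: card_orbit_square_perm[OF p fin]\<close>)
    also have "\<dots> = (\<Sum>(a, b)\<in>?L. i * (?k a * ?k b * gcd a b))"
    proof (rule sum.cong[OF refl], clarify)
      fix a b assume ab: "a \<in> {1..n}" "b \<in> {1..n}" and i: "i = lcm a b"
      have "{z \<in> {z \<in> A \<times> A. card (orbit ?sq z) = lcm a b}. ?g z = (a, b)}
          = {x \<in> A. card (orbit p x) = a} \<times> {y \<in> A. card (orbit p y) = b}"
        by (auto simp: card_orbit_square_perm[OF p fin])
      then have "(\<Sum>z\<in>{z \<in> {z \<in> A \<times> A. card (orbit ?sq z) = lcm a b}. ?g z = (a, b)}. 1)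
          = (a * b) * (?k a * ?k b)"
        using count_cycle_type_mult[OF p fin] by (simp add: card_cartesian_product)
      also have "a * b = lcm a b * gcd a b" by (metis mult.commute prod_gcd_lcm_nat)
      finally show "(\<Sum>z\<in>{z \<in> {z \<in> A \<times> A. card (orbit ?sq z) = lcm a b}. ?g z = (a, b)}. 1)
          = lcm a b * (?k a * ?k b * gcd a b)" by simp
    qed
    also have "\<dots> = i * (\<Sum>(a, b)\<in>?L. ?k a * ?k b * gcd a b)"
      by (simp add: sum_distrib_left case_prod_unfold)
    finally show ?thesis using i by simp
  qed
  have "(\<Prod>O'\<in>orbit ?sq ` (A \<times> A). F (card O')) = (\<Prod>i\<in>?S. F i ^ count (cycle_type ?sq (A \<times> A)) i)"
  proof (rule prod_over_orbits)
    show "card ` orbit ?sq ` (A \<times> A) \<subseteq> ?S"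
    proof clarify
      fix x y assume xy: "x \<in> A" "y \<in> A"
      have "(\<lambda>(a, b). lcm a b) (card (orbit p x), card (orbit p y)) \<in> ?S"
        using mem xy by (intro imageI) auto
      then show "card (orbit ?sq (x, y)) \<in> ?S"
        by (simp only: card_orbit_square_perm[OF p fin xy] prod.case)
    qed
  qed (use fin in auto)
  also have "\<dots> = (\<Prod>i\<in>?S. \<Prod>c\<in>{c \<in> ?N. (\<lambda>(a, b). lcm a b) c = i}.
      (\<lambda>(a, b). F (lcm a b) ^ (?k a * ?k b * gcd a b)) c)"
  proof (rule prod.cong[OF refl])
    fix i assume "i \<in> ?S"
    have "(\<Prod>c\<in>{c \<in> ?N. (\<lambda>(a, b). lcm a b) c = i}. (\<lambda>(a, b). F (lcm a b) ^ (?k a * ?k b * gcd a b)) c)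
       = (\<Prod>c\<in>{c \<in> ?N. (\<lambda>(a, b). lcm a b) c = i}. F i ^ (\<lambda>(a, b). ?k a * ?k b * gcd a b) c)"
      by (rule prod.cong) auto
    also have "\<dots> = F i ^ count (cycle_type ?sq (A \<times> A)) i"
      by (simp add: count[OF \<open>i \<in> ?S\<close>] power_sum)
    finally show "F i ^ count (cycle_type ?sq (A \<times> A)) i = (\<Prod>c\<in>{c \<in> ?N. (\<lambda>(a, b). lcm a b) c = i}.
      (\<lambda>(a, b). F (lcm a b) ^ (?k a * ?k b * gcd a b)) c)" by simp
  qed
  also have "\<dots> = (\<Prod>c\<in>?N. (\<lambda>(a, b). F (lcm a b) ^ (?k a * ?k b * gcd a b)) c)"
    by (rule prod.group) auto
  also have "\<dots> = (\<Prod>a\<in>{1..n}. \<Prod>b\<in>{1..n}. F (lcm a b) ^ (?k a * ?k b * gcd a b))"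
    by (simp only: prod.cartesian_product)
  finally show ?thesis .
qed

subsection \<open>Classes of multiplication tables\<close>

text \<open>The assignment from \<open>u x\<close> to \<open>v x\<close> is well defined and
  bijective. This compares numbers of classes when the classes themselves are different
  sets.\<close>

lemma card_image_cong_kernel:
  assumes "\<And>x y. x \<in> E \<Longrightarrow> y \<in> E \<Longrightarrow> u x = u y \<longleftrightarrow> v x = v y"
  shows "card (u ` E) = card (v ` E)"
proof (rule bij_betw_same_card[OF bij_betwI'])
  define w where "w z = v (SOME x. x \<in> E \<and> u x = z)" for z
  have w: "w (u x) = v x" if "x \<in> E" for x
  proof -
    have "\<exists>y. y \<in> E \<and> u y = u x" using that by blast
    from someI_ex[OF this] show ?thesis unfolding w_def using assms that by blast
  qed
  show "w a = w b \<longleftrightarrow> a = b" if "a \<in> u ` E" "b \<in> u ` E" for a b using that w assms by auto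
  show "w a \<in> v ` E" if "a \<in> u ` E" for a using that w by auto
  show "\<exists>a\<in>u ` E. b = w a" if "b \<in> v ` E" for b using that w by auto
qed

text \<open>A class may reach outside \<open>E\<close>, where \<open>R\<close> and \<open>S\<close>
  need not agree; only the coincidences between classes of elements of \<open>E\<close>
  matter.\<close>

lemma card_quotient_cong:
  assumes "\<And>x y. x \<in> E \<Longrightarrow> y \<in> E \<Longrightarrow> R `` {x} = R `` {y} \<longleftrightarrow> S `` {x} = S `` {y}"
  shows "card (E // R) = card (E // S)"
proof -
  have "E // T = (\<lambda>x. T `` {x}) ` E" for T by (auto simp: quotient_def)
  then show ?thesis using card_image_cong_kernel[of E, OF assms] by simp
qed

text \<open>The complements of \<open>S\<close> and of its image have equal size, so any bijection
  between them completes \<open>b\<close>.\<close>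

lemma inj_on_extends_to_permutation:
  assumes fin: "finite T" and inj: "inj_on b S" and sub: "S \<subseteq> T" "b ` S \<subseteq> T"
  shows "\<exists>q. q permutes T \<and> (\<forall>s\<in>S. q s = b s)"
proof -
  have "card (T - S) = card (T - b ` S)"
    using fin sub inj by (simp add: card_Diff_subset finite_subset card_image)
  then obtain h where h: "bij_betw h (T - S) (T - b ` S)"
    using fin finite_same_card_bij by blast
  define q where "q x = (if x \<in> S then b x else if x \<in> T then h x else x)" for x
  have "bij_betw q S (b ` S)"
    using inj by (simp add: q_def bij_betw_def inj_on_def)
  moreover have "bij_betw q (T - S) (T - b ` S)"
    using h by (subst bij_betw_cong[of _ _ h]) (auto simp: q_def)
  ultimately have "bij_betw q (S \<union> (T - S)) (b ` S \<union> (T - b ` S))"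
    by (rule bij_betw_combine) auto
  then have "bij_betw q T T" using sub by (simp add: Un_absorb1)
  then have "q permutes T" using sub by (intro bij_imp_permutes) (auto simp: q_def)
  then show ?thesis by (auto simp: q_def)
qed

text \<open>The number \<open>0\<close> plays the zero of the semigroup, \<open>{1..c}\<close> its other products and \<open>A\<close> the
  elements that are not products.\<close>

definition tables :: "nat set \<Rightarrow> nat \<Rightarrow> (nat \<Rightarrow> nat \<Rightarrow> nat) set" where
  "tables A c = {f. \<forall>x y. f x y \<le> c \<and> (f x y \<noteq> 0 \<longrightarrow> x \<in> A \<and> y \<in> A)}"

text \<open>Letting the value relabelling range over all bijections of the naturals fixing \<open>0\<close>
  makes the relation independent of the bound \<open>c\<close> on the values.\<close>

definition table_rel :: "nat set \<Rightarrow> ((nat \<Rightarrow> nat \<Rightarrow> nat) \<times> (nat \<Rightarrow> nat \<Rightarrow> nat)) set" where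
  "table_rel A = {(f, g). \<exists>\<alpha> \<beta>. \<alpha> permutes A \<and> bij \<beta> \<and> \<beta> 0 = 0 \<and>
    (\<forall>x y. g (\<alpha> x) (\<alpha> y) = \<beta> (f x y))}"

lemma equiv_table_rel: "equiv UNIV (table_rel A)"
proof (rule equivI)
  show "refl (table_rel A)"
    unfolding refl_on_def table_rel_def using permutes_id[of A] by (auto intro!: exI[of _ id])
  show "sym (table_rel A)"
  proof (rule symI)
    fix f g assume "(f, g) \<in> table_rel A"
    then obtain \<alpha> \<beta> where ab: "\<alpha> permutes A" "bij \<beta>" "\<beta> 0 = 0"
      "\<And>x y. g (\<alpha> x) (\<alpha> y) = \<beta> (f x y)" unfolding table_rel_def by blast
    have "f (inv_into UNIV \<alpha> x) (inv_into UNIV \<alpha> y) = inv_into UNIV \<beta> (g x y)" for x y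
      using ab(4)[of "inv_into UNIV \<alpha> x" "inv_into UNIV \<alpha> y"] permutes_inverses(1)[OF ab(1)]
        inv_f_f[OF bij_is_inj[OF ab(2)]] by simp
    moreover have "inv_into UNIV \<beta> 0 = 0" using ab(2,3) by (metis bij_inv_eq_iff)
    ultimately show "(g, f) \<in> table_rel A"
      unfolding table_rel_def using permutes_inv[OF ab(1)] bij_imp_bij_inv[OF ab(2)] by blast
  qed
  show "trans (table_rel A)"
  proof (rule transI)
    fix f g h assume "(f, g) \<in> table_rel A" "(g, h) \<in> table_rel A"
    then obtain \<alpha> \<beta> \<alpha>' \<beta>' where ab: "\<alpha> permutes A" "bij \<beta>" "\<beta> 0 = 0"
      "\<And>x y. g (\<alpha> x) (\<alpha> y) = \<beta> (f x y)" and ab': "\<alpha>' permutes A" "bij \<beta>'" "\<beta>' 0 = 0"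
      "\<And>x y. h (\<alpha>' x) (\<alpha>' y) = \<beta>' (g x y)" unfolding table_rel_def by blast
    have "\<alpha>' \<circ> \<alpha> permutes A" "bij (\<beta>' \<circ> \<beta>)" "(\<beta>' \<circ> \<beta>) 0 = 0"
      "\<forall>x y. h ((\<alpha>' \<circ> \<alpha>) x) ((\<alpha>' \<circ> \<alpha>) y) = (\<beta>' \<circ> \<beta>) (f x y)"
      using ab ab' permutes_compose bij_comp by auto
    then show "(f, h) \<in> table_rel A" unfolding table_rel_def by blast
  qed
qed simp

lemma table_rel_image_eq_iff: "table_rel A `` {f} = table_rel A `` {g} \<longleftrightarrow> (f, g) \<in> table_rel A"
  by (meson UNIV_I equiv_table_rel eq_equiv_class_iff)

text \<open>Only the action of \<beta> on the nonzero values of \<open>f\<close> matters. It sends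
  them injectively to values of \<open>g\<close>, which are at most \<open>c\<close>, so this part
  extends to a permutation of \<open>{1..c}\<close>. This puts a finite group behind the
  relation.\<close>

lemma table_rel_iff_permutes:
  assumes f: "f \<in> tables A c" and g: "g \<in> tables A c"
  shows "(f, g) \<in> table_rel A \<longleftrightarrow>
    (\<exists>\<alpha> \<beta>. \<alpha> permutes A \<and> \<beta> permutes {1..c} \<and> (\<forall>x y. g (\<alpha> x) (\<alpha> y) = \<beta> (f x y)))"
proof
  assume "(f, g) \<in> table_rel A"
  then obtain \<alpha> \<beta> where ab: "\<alpha> permutes A" "bij \<beta>" "\<beta> 0 = 0"
    "\<And>x y. g (\<alpha> x) (\<alpha> y) = \<beta> (f x y)" unfolding table_rel_def by blast
  define S where "S = {v. v \<noteq> 0 \<and> (\<exists>x y. v = f x y)}"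
  have "\<beta> v \<in> {1..c}" if vS: "v \<in> S" for v
  proof -
    obtain x y where v: "v = f x y" "v \<noteq> 0" using vS unfolding S_def by blast
    have "\<beta> v \<noteq> 0" using v(2) ab(2,3) by (metis bij_inv_eq_iff)
    moreover have "\<beta> v \<le> c" using g ab(4)[of x y] v(1) by (metis (mono_tags, lifting) mem_Collect_eq tables_def)
    ultimately show ?thesis by simp
  qed
  then have "\<beta> ` S \<subseteq> {1..c}" by (rule image_subsetI)
  moreover have "S \<subseteq> {1..c}" using f by (auto simp: S_def tables_def Suc_le_eq)
  moreover have "inj_on \<beta> S" using ab(2) by (meson bij_is_inj inj_on_subset subset_UNIV)
  ultimately obtain q where q: "q permutes {1..c}" "\<forall>s\<in>S. q s = \<beta> s"
    using inj_on_extends_to_permutation[of "{1..c}" \<beta> S] by auto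
  have "q 0 = 0" using permutes_not_in[OF q(1)] by simp
  then have "q (f x y) = \<beta> (f x y)" for x y
    using q(2) ab(3) by (cases "f x y = 0") (auto simp: S_def)
  then show "\<exists>\<alpha> \<beta>. \<alpha> permutes A \<and> \<beta> permutes {1..c} \<and> (\<forall>x y. g (\<alpha> x) (\<alpha> y) = \<beta> (f x y))"
    using ab(1,4) q(1) by metis
next
  assume "\<exists>\<alpha> \<beta>. \<alpha> permutes A \<and> \<beta> permutes {1..c} \<and> (\<forall>x y. g (\<alpha> x) (\<alpha> y) = \<beta> (f x y))"
  then obtain \<alpha> \<beta> where ab: "\<alpha> permutes A" "\<beta> permutes {1..c}" "\<forall>x y. g (\<alpha> x) (\<alpha> y) = \<beta> (f x y)"
    by blast
  moreover have "\<beta> 0 = 0" using permutes_not_in[OF ab(2)] by simp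
  ultimately show "(f, g) \<in> table_rel A"
    unfolding table_rel_def using permutes_bij[OF ab(2)] by blast
qed

lemma bij_betw_tables_functions:
  "bij_betw (\<lambda>f. \<lambda>z\<in>A \<times> A. f (fst z) (snd z)) (tables A c) (A \<times> A \<rightarrow>\<^sub>E {0..c})"
proof (rule bij_betw_byWitness[where f' = "\<lambda>h x y. if x \<in> A \<and> y \<in> A then h (x, y) else 0"])
  show "\<forall>f\<in>tables A c. (\<lambda>x y. if x \<in> A \<and> y \<in> A then (\<lambda>z\<in>A \<times> A. f (fst z) (snd z)) (x, y) else 0) = f"
    by (fastforce simp: tables_def fun_eq_iff)
  show "\<forall>h\<in>A \<times> A \<rightarrow>\<^sub>E {0..c}. (\<lambda>z\<in>A \<times> A. if fst z \<in> A \<and> snd z \<in> A then h (fst z, snd z) else 0) = h"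
    by (auto simp: PiE_def extensional_def fun_eq_iff restrict_def)
qed (auto simp: tables_def PiE_def Pi_def split: if_splits)

lemma finite_tables: "finite A \<Longrightarrow> finite (tables A c)"
  using bij_betw_finite[OF bij_betw_tables_functions[of A c]] by (simp add: finite_PiE)

section \<open>Burnside's lemma for relabelled tables\<close>

definition perm_group :: "'a set \<Rightarrow> ('a \<Rightarrow> 'a) monoid" where
  "perm_group A = \<lparr>carrier = {p. p permutes A}, mult = (\<circ>), one = id\<rparr>"

lemma perm_group_simps [simp]:
  "carrier (perm_group A) = {p. p permutes A}"
  "mult (perm_group A) = (\<circ>)"
  "one (perm_group A) = id"
  by (simp_all add: perm_group_def)

lemma group_perm_group: "group (perm_group A)"
proof (rule groupI)
  show "\<exists>q\<in>carrier (perm_group A). q \<otimes>\<^bsub>perm_group A\<^esub> p = \<one>\<^bsub>perm_group A\<^esub>"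
    if "p \<in> carrier (perm_group A)" for p
    using that permutes_inv[of p A] permutes_inv_o(2)[of p A]
    by (intro bexI[of _ "inv_into UNIV p"]) auto
qed (auto intro: permutes_compose)

text \<open>Inverses on the arguments make this a left action; \<open>relabel_eq_iff\<close> gives
  the form without inverses.\<close>

definition relabel :: "(nat \<Rightarrow> nat) \<times> (nat \<Rightarrow> nat) \<Rightarrow> (nat \<Rightarrow> nat \<Rightarrow> nat) \<Rightarrow> nat \<Rightarrow> nat \<Rightarrow> nat" where
  "relabel g f = (\<lambda>x y. snd g (f (inv_into UNIV (fst g) x) (inv_into UNIV (fst g) y)))"

lemma relabel_in_tables:
  assumes "\<alpha> permutes A" "\<beta> permutes {1..c}" "f \<in> tables A c"
  shows "relabel (\<alpha>, \<beta>) f \<in> tables A c"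
proof -
  have b0: "\<beta> 0 = 0" using permutes_not_in[OF assms(2)] by simp
  have "\<beta> v \<le> c" if "v \<le> c" for v
    using that b0 permutes_in_image[OF assms(2), of v] by (cases "v = 0") auto
  moreover have "x \<in> A \<and> y \<in> A" if "\<beta> (f (inv_into UNIV \<alpha> x) (inv_into UNIV \<alpha> y)) \<noteq> 0" for x y
  proof -
    have "f (inv_into UNIV \<alpha> x) (inv_into UNIV \<alpha> y) \<noteq> 0" using that b0 by metis
    then show ?thesis
      using assms(3) permutes_in_image[OF permutes_inv[OF assms(1)]] unfolding tables_def by blast
  qed
  ultimately show ?thesis using assms(3) by (auto simp: tables_def relabel_def)
qed

lemma relabel_comp:
  assumes "bij \<alpha>" "bij \<alpha>'"
  shows "relabel (\<alpha> \<circ> \<alpha>', \<beta> \<circ> \<beta>') f = relabel (\<alpha>, \<beta>) (relabel (\<alpha>', \<beta>') f)"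
  by (simp add: relabel_def o_inv_distrib assms)

lemma relabel_id [simp]: "relabel (id, id) f = f"
  by (simp add: relabel_def)

lemma relabel_eq_iff:
  assumes "\<alpha> permutes A"
  shows "relabel (\<alpha>, \<beta>) f = g \<longleftrightarrow> (\<forall>x y. g (\<alpha> x) (\<alpha> y) = \<beta> (f x y))"
proof
  assume "relabel (\<alpha>, \<beta>) f = g"
  then show "\<forall>x y. g (\<alpha> x) (\<alpha> y) = \<beta> (f x y)"
    by (auto simp: relabel_def permutes_inverses(2)[OF assms])
next
  assume *: "\<forall>x y. g (\<alpha> x) (\<alpha> y) = \<beta> (f x y)"
  show "relabel (\<alpha>, \<beta>) f = g"
  proof (intro ext)
    fix x y
    show "relabel (\<alpha>, \<beta>) f x y = g x y"
      using *[rule_format, of "inv_into UNIV \<alpha> x" "inv_into UNIV \<alpha> y"]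
      by (simp add: relabel_def permutes_inverses(1)[OF assms])
  qed
qed

abbreviation table_group :: "nat set \<Rightarrow> nat \<Rightarrow> ((nat \<Rightarrow> nat) \<times> (nat \<Rightarrow> nat)) monoid" where
  "table_group A c \<equiv> perm_group A \<times>\<times> perm_group {1..c}"

lemma bij_betw_relabel:
  assumes "\<alpha> permutes A" "\<beta> permutes {1..c}"
  shows "bij_betw (relabel (\<alpha>, \<beta>)) (tables A c) (tables A c)"
proof (rule bij_betw_byWitness[where f' = "relabel (inv_into UNIV \<alpha>, inv_into UNIV \<beta>)"])
  note inv = permutes_inv[OF assms(1)] permutes_inv[OF assms(2)]
  note bij = permutes_bij[OF assms(1)] permutes_bij[OF inv(1)]
  show "\<forall>f\<in>tables A c. relabel (inv_into UNIV \<alpha>, inv_into UNIV \<beta>) (relabel (\<alpha>, \<beta>) f) = f"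
    by (simp add: relabel_comp[symmetric] bij permutes_inv_o[OF assms(1)] permutes_inv_o[OF assms(2)])
  show "\<forall>f\<in>tables A c. relabel (\<alpha>, \<beta>) (relabel (inv_into UNIV \<alpha>, inv_into UNIV \<beta>) f) = f"
    by (simp add: relabel_comp[symmetric] bij permutes_inv_o[OF assms(1)] permutes_inv_o[OF assms(2)])
  show "relabel (\<alpha>, \<beta>) ` tables A c \<subseteq> tables A c"
    using relabel_in_tables[OF assms] by blast
  show "relabel (inv_into UNIV \<alpha>, inv_into UNIV \<beta>) ` tables A c \<subseteq> tables A c"
    using relabel_in_tables[OF inv] by blast
qed

text \<open>The elements of \<open>BijGroup\<close> are extensional functions, whence the
  \<open>restrict\<close>.\<close>

lemma group_action_relabel:
  "group_action (table_group A c) (tables A c) (\<lambda>g. restrict (relabel g) (tables A c))"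
  unfolding group_action_def group_hom_def group_hom_axioms_def
proof (intro conjI)
  let ?\<phi> = "\<lambda>g. restrict (relabel g) (tables A c)"
  show "group (table_group A c)" by (intro DirProd_group group_perm_group)
  show "group (BijGroup (tables A c))" by (rule group_BijGroup)
  show "?\<phi> \<in> hom (table_group A c) (BijGroup (tables A c))"
  proof (rule homI)
    fix g assume g: "g \<in> carrier (table_group A c)"
    then show "?\<phi> g \<in> carrier (BijGroup (tables A c))"
      using bij_betw_relabel by (cases g) (auto simp: BijGroup_def Bij_def bij_betw_def inj_on_def)
    fix h assume h: "h \<in> carrier (table_group A c)"
    have Bij: "?\<phi> k \<in> Bij (tables A c)" if "k \<in> carrier (table_group A c)" for k
      using that bij_betw_relabel by (cases k) (auto simp: Bij_def bij_betw_def inj_on_def)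
    obtain \<alpha> \<beta> \<alpha>' \<beta>' where gh: "g = (\<alpha>, \<beta>)" "h = (\<alpha>', \<beta>')" by (cases g, cases h)
    then have p: "\<alpha> permutes A" "\<beta> permutes {1..c}" "\<alpha>' permutes A" "\<beta>' permutes {1..c}" using g h by auto
    have "?\<phi> (g \<otimes>\<^bsub>table_group A c\<^esub> h) = compose (tables A c) (?\<phi> g) (?\<phi> h)"
      using relabel_in_tables[OF p(3,4)] permutes_bij[OF p(1)] permutes_bij[OF p(3)]
      by (auto simp: gh compose_def fun_eq_iff restrict_def relabel_comp)
    then show "?\<phi> (g \<otimes>\<^bsub>table_group A c\<^esub> h) = ?\<phi> g \<otimes>\<^bsub>BijGroup (tables A c)\<^esub> ?\<phi> h"
      using Bij[OF g] Bij[OF h] by (simp add: BijGroup_def)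
  qed
qed

text \<open>Orbits stay inside \<open>tables A c\<close>, whereas classes of
  \<open>table_rel\<close> may contain tables with larger values. The two families differ as sets
  but have the same size.\<close>

lemma card_orbits_relabel:
  "card (orbits (table_group A c) (tables A c) (\<lambda>g. restrict (relabel g) (tables A c)))
    = card (tables A c // table_rel A)"
proof -
  let ?G = "table_group A c" and ?E = "tables A c"
  let ?\<phi> = "\<lambda>g. restrict (relabel g) ?E"
  interpret group_action ?G ?E ?\<phi> by (rule group_action_relabel)
  have mem: "g \<in> Group_Action.orbit ?G ?\<phi> f \<longleftrightarrow> (f, g) \<in> table_rel A" if "f \<in> ?E" "g \<in> ?E" for f g
  proof -
    have "g \<in> Group_Action.orbit ?G ?\<phi> f
        \<longleftrightarrow> (\<exists>\<alpha> \<beta>. \<alpha> permutes A \<and> \<beta> permutes {1..c} \<and> relabel (\<alpha>, \<beta>) f = g)"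
      using that(1) by (auto simp: Group_Action.orbit_def)
    also have "\<dots> \<longleftrightarrow> (f, g) \<in> table_rel A"
      unfolding table_rel_iff_permutes[OF that] by (intro ex_cong1 conj_cong refl relabel_eq_iff)
    finally show ?thesis .
  qed
  have eq: "Group_Action.orbit ?G ?\<phi> f = Group_Action.orbit ?G ?\<phi> g
      \<longleftrightarrow> table_rel A `` {f} = table_rel A `` {g}" if "f \<in> ?E" "g \<in> ?E" for f g
  proof -
    have "Group_Action.orbit ?G ?\<phi> f = Group_Action.orbit ?G ?\<phi> g \<longleftrightarrow> g \<in> Group_Action.orbit ?G ?\<phi> f"
      using disjoint_union[of "Group_Action.orbit ?G ?\<phi> f" "Group_Action.orbit ?G ?\<phi> g"]
        orbit_refl[OF that(2)] that by (auto simp: orbits_def)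
    then show ?thesis using mem[OF that] table_rel_image_eq_iff by simp
  qed
  have "orbits ?G ?E ?\<phi> = Group_Action.orbit ?G ?\<phi> ` ?E" by (auto simp: orbits_def)
  moreover have "?E // table_rel A = (\<lambda>f. table_rel A `` {f}) ` ?E" by (auto simp: quotient_def)
  ultimately show ?thesis
    using card_image_cong_kernel[of ?E, OF eq] by simp
qed

text \<open>Being fixed means being equivariant from the square of \<open>A\<close> to
  \<open>{0..c}\<close>, so each cycle of pairs contributes the number of admissible values. The
  leading 1 is the value 0, which \<beta> fixes.\<close>

lemma card_relabel_fixed_points:
  assumes a: "\<alpha> permutes A" and b: "\<beta> permutes {1..c}" and fin: "finite A" and r: "r = card A"
  shows "real (card {f \<in> tables A c. relabel (\<alpha>, \<beta>) f = f})
    = (\<Prod>k\<in>{1..r}. \<Prod>l\<in>{1..r}. (1 + real (\<Sum>d | 0 < d \<and> d dvd lcm k l. d * count (cycle_type \<beta> {1..c}) d))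
        ^ (count (cycle_type \<alpha> A) k * count (cycle_type \<alpha> A) l * gcd k l))"
proof -
  let ?F = "\<lambda>t. 1 + real (\<Sum>d | 0 < d \<and> d dvd t. d * count (cycle_type \<beta> {1..c}) d)"
  let ?j = "\<lambda>f. \<lambda>z\<in>A \<times> A. f (fst z) (snd z)"
  let ?sq = "square_perm A \<alpha>"
  note sq = square_perm_permutes[OF a]
  have perm2: "permutation ?sq"
    using permutes_imp_permutation[OF _ sq] fin by simp
  have b0: "\<beta> 0 = 0" using permutes_not_in[OF b] by simp
  have iff: "(\<forall>z\<in>A \<times> A. ?j f (?sq z) = \<beta> (?j f z)) \<longleftrightarrow> relabel (\<alpha>, \<beta>) f = f" if f: "f \<in> tables A c" for f
  proof -
    have "relabel (\<alpha>, \<beta>) f = f \<longleftrightarrow> (\<forall>x\<in>A. \<forall>y\<in>A. f (\<alpha> x) (\<alpha> y) = \<beta> (f x y))"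
    proof -
      have "f (\<alpha> x) (\<alpha> y) = \<beta> (f x y)" if "\<not> (x \<in> A \<and> y \<in> A)" for x y
      proof -
        have "f x y = 0" "f (\<alpha> x) (\<alpha> y) = 0"
          using f that permutes_in_image[OF a] unfolding tables_def by blast+
        then show ?thesis using b0 by simp
      qed
      then show ?thesis unfolding relabel_eq_iff[OF a] by blast
    qed
    then show ?thesis using permutes_in_image[OF a] by (auto simp: square_perm_apply)
  qed
  have "bij_betw ?j {f \<in> tables A c. relabel (\<alpha>, \<beta>) f = f}
      {h \<in> A \<times> A \<rightarrow>\<^sub>E {0..c}. \<forall>z\<in>A \<times> A. h (?sq z) = \<beta> (h z)}"
  proof (rule bij_betw_subset[OF bij_betw_tables_functions])
    show "?j ` {f \<in> tables A c. relabel (\<alpha>, \<beta>) f = f}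
        = {h \<in> A \<times> A \<rightarrow>\<^sub>E {0..c}. \<forall>z\<in>A \<times> A. h (?sq z) = \<beta> (h z)}"
      unfolding bij_betw_imp_surj_on[OF bij_betw_tables_functions[of A c], symmetric]
      using iff by blast
  qed auto
  then have "card {f \<in> tables A c. relabel (\<alpha>, \<beta>) f = f}
      = card {h \<in> A \<times> A \<rightarrow>\<^sub>E {0..c}. \<forall>z\<in>A \<times> A. h (?sq z) = \<beta> (h z)}"
    by (rule bij_betw_same_card)
  also have "\<dots> = (\<Prod>O'\<in>Orbits.orbit ?sq ` (A \<times> A). card {y \<in> {0..c}. (\<beta> ^^ card O') y = y})"
  proof (rule card_equivariant_functions[OF sq])
    have "\<beta> permutes {0..c}" using b by (rule permutes_subset) auto
    then show "\<beta> ` {0..c} \<subseteq> {0..c}" using permutes_image by blast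
  qed (use fin in simp)
  also have "real \<dots> = (\<Prod>O'\<in>Orbits.orbit ?sq ` (A \<times> A). ?F (card O'))"
    unfolding of_nat_prod
  proof (rule prod.cong[OF refl])
    fix O' assume "O' \<in> Orbits.orbit ?sq ` (A \<times> A)"
    then have pos: "0 < card O'" using card_orbit_pos[OF perm2] by auto
    have "(\<beta> ^^ n) 0 = 0" for n by (induct n) (use b0 in auto)
    then have "{y \<in> {0..c}. (\<beta> ^^ card O') y = y} = insert 0 {y \<in> {1..c}. (\<beta> ^^ card O') y = y}"
      by (auto simp: Suc_le_eq)
    moreover have "finite {y \<in> {1..c}. (\<beta> ^^ card O') y = y}" by simp
    ultimately have "card {y \<in> {0..c}. (\<beta> ^^ card O') y = y} = Suc (card {y \<in> {1..c}. (\<beta> ^^ card O') y = y})"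
      by (simp only: card_insert_disjoint) simp
    then show "real (card {y \<in> {0..c}. (\<beta> ^^ card O') y = y}) = ?F (card O')"
      using card_funpow_fixed_points[OF b _ pos] by simp
  qed
  also have "\<dots> = (\<Prod>k\<in>{1..r}. \<Prod>l\<in>{1..r}. ?F (lcm k l)
      ^ (count (cycle_type \<alpha> A) k * count (cycle_type \<alpha> A) l * gcd k l))"
    by (rule prod_orbits_square_perm[OF a fin r])
  finally show ?thesis .
qed

text \<open>A class function is summed class by class. The factorial is kept in front so that it
  cancels against the group order in Burnside's lemma.\<close>

lemma sum_over_cycle_types:
  fixes H :: "nat multiset \<Rightarrow> real"
  assumes fin: "finite A"
  shows "(\<Sum>p | p permutes A. H (cycle_type p A))
    = fact (card A) * (\<Sum>M\<in>partitions_of (card A). inverse (centralizer_order M) * H M)"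
proof -
  let ?P = "{p. p permutes A}"
  \<comment> \<open>Every partition occurs as a cycle type, because the class size just computed is
    not zero.\<close>
  have img: "(\<lambda>p. cycle_type p A) ` ?P = partitions_of (card A)"
  proof
    show "partitions_of (card A) \<subseteq> (\<lambda>p. cycle_type p A) ` ?P"
    proof
      fix M assume M: "M \<in> partitions_of (card A)"
      then have "0 < centralizer_order M" by (intro centralizer_order_pos) (simp add: partitions_of_def)
      then have "real (card {p. p permutes A \<and> cycle_type p A = M}) \<noteq> 0"
        using card_permutations_of_cycle_type[OF fin M] by simp
      then have "{p. p permutes A \<and> cycle_type p A = M} \<noteq> {}" by force
      then show "M \<in> (\<lambda>p. cycle_type p A) ` ?P" by auto
    qed
  qed (use cycle_type_in_partitions_of[OF _ fin] in auto)
  have "(\<Sum>p\<in>?P. H (cycle_type p A))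
      = (\<Sum>M\<in>partitions_of (card A). \<Sum>p\<in>{p \<in> ?P. cycle_type p A = M}. H (cycle_type p A))"
    using sum.image_gen[OF finite_permutations[OF fin], of "\<lambda>p. H (cycle_type p A)" "\<lambda>p. cycle_type p A"]
    by (simp add: img)
  also have "\<dots> = (\<Sum>M\<in>partitions_of (card A). fact (card A) * (inverse (centralizer_order M) * H M))"
  proof (rule sum.cong[OF refl])
    fix M assume M: "M \<in> partitions_of (card A)"
    have "(\<Sum>p\<in>{p \<in> ?P. cycle_type p A = M}. H (cycle_type p A)) = (\<Sum>p\<in>{p \<in> ?P. cycle_type p A = M}. H M)"
      by (rule sum.cong) auto
    then show "(\<Sum>p\<in>{p \<in> ?P. cycle_type p A = M}. H (cycle_type p A))
        = fact (card A) * (inverse (centralizer_order M) * H M)"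
      using card_permutations_of_cycle_type[OF fin M] by (simp add: field_simps)
  qed
  finally show ?thesis by (simp add: sum_distrib_left)
qed

lemma centralizer_order_partition:
  assumes "M \<in> partitions_of n"
  shows "(\<Prod>i\<in>{1..n}. real (fact (count M i)) * real i ^ count M i) = centralizer_order M"
  using centralizer_order_superset[OF _ set_mset_partition_subset[OF assms]] by simp

text \<open>Burnside's lemma for a group of order \<open>fact r * fact c\<close>. The argument
  \<open>Suc c\<close> of \<open>NN\<close> counts the zero among the products, and adding the
  elements of \<open>A\<close> gives the order of the semigroup.\<close>

theorem card_table_classes:
  assumes fin: "finite A"
  shows "real (card (tables A c // table_rel A)) = NN (card A + Suc c) (Suc c)"
proof -
  let ?G = "table_group A c" and ?E = "tables A c"
  let ?\<phi> = "\<lambda>g. restrict (relabel g) ?E"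
  interpret group_action ?G ?E ?\<phi> by (rule group_action_relabel)
  define r where "r = card A"
  define H where "H j k = (\<Prod>a\<in>{1..r}. \<Prod>b\<in>{1..r}. (1 + real (\<Sum>d | 0 < d \<and> d dvd lcm a b. d * count j d))
        ^ (count k a * count k b * gcd a b))" for j k
  have carrier: "carrier ?G = {p. p permutes A} \<times> {p. p permutes {1..c}}" by simp
  have finG: "finite (carrier ?G)" unfolding carrier by (intro finite_cartesian_product finite_permutations fin) simp
  have order: "order ?G = fact r * fact c"
    using card_permutations[OF refl fin] card_permutations[of "{1..c}" c]
    by (simp add: order_def carrier card_cartesian_product r_def)
  have "real (card (?E // table_rel A)) * (fact r * fact c)
      = real (\<Sum>g\<in>carrier ?G. card (invariants ?E ?\<phi> g))"
    using burnside[OF finG finite_tables[OF fin]] unfolding card_orbits_relabel order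
    by (metis of_nat_fact of_nat_mult)
  also have "\<dots> = (\<Sum>\<alpha> | \<alpha> permutes A. \<Sum>\<beta> | \<beta> permutes {1..c}. real (card (invariants ?E ?\<phi> (\<alpha>, \<beta>))))"
    unfolding carrier by (simp add: sum.cartesian_product)
  also have "\<dots> = (\<Sum>\<alpha> | \<alpha> permutes A. \<Sum>\<beta> | \<beta> permutes {1..c}. H (cycle_type \<beta> {1..c}) (cycle_type \<alpha> A))"
  proof (intro sum.cong refl)
    fix \<alpha> \<beta> assume ab: "\<alpha> \<in> {\<alpha>. \<alpha> permutes A}" "\<beta> \<in> {\<beta>. \<beta> permutes {1..c}}"
    have "invariants ?E ?\<phi> (\<alpha>, \<beta>) = {f \<in> ?E. relabel (\<alpha>, \<beta>) f = f}"
      by (auto simp: invariants_def)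
    then show "real (card (invariants ?E ?\<phi> (\<alpha>, \<beta>))) = H (cycle_type \<beta> {1..c}) (cycle_type \<alpha> A)"
      using card_relabel_fixed_points[OF _ _ fin r_def] ab by (simp add: H_def)
  qed
  also have "\<dots> = (\<Sum>\<alpha> | \<alpha> permutes A.
      fact c * (\<Sum>j\<in>partitions_of c. inverse (centralizer_order j) * H j (cycle_type \<alpha> A)))"
  proof (rule sum.cong[OF refl])
    fix \<alpha>
    show "(\<Sum>\<beta> | \<beta> permutes {1..c}. H (cycle_type \<beta> {1..c}) (cycle_type \<alpha> A))
      = fact c * (\<Sum>j\<in>partitions_of c. inverse (centralizer_order j) * H j (cycle_type \<alpha> A))"
      using sum_over_cycle_types[of "{1..c}" "\<lambda>j. H j (cycle_type \<alpha> A)"] by simp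
  qed
  also have "\<dots> = fact r * (\<Sum>k\<in>partitions_of r. inverse (centralizer_order k) *
      (fact c * (\<Sum>j\<in>partitions_of c. inverse (centralizer_order j) * H j k)))"
    unfolding r_def by (rule sum_over_cycle_types[OF fin])
  also have "\<dots> = (fact r * fact c) * (\<Sum>j\<in>partitions_of c. \<Sum>k\<in>partitions_of r.
      inverse (centralizer_order j * centralizer_order k) * H j k)"
    by (subst sum.swap) (simp add: sum_distrib_left mult_ac)
  also have "(\<Sum>j\<in>partitions_of c. \<Sum>k\<in>partitions_of r.
      inverse (centralizer_order j * centralizer_order k) * H j k) = NN (r + Suc c) (Suc c)"
  proof -
    have sizes: "Suc c - 1 = c" "r + Suc c - Suc c = r" by simp_all
    show ?thesis
      unfolding NN_def H_def sizes
      by (intro sum.cong refl) (simp only: centralizer_order_partition)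
  qed
  finally show ?thesis by (simp add: r_def)
qed

subsection \<open>Nilpotent semigroups\<close>

definition onto_tables :: "nat set \<Rightarrow> nat \<Rightarrow> (nat \<Rightarrow> nat \<Rightarrow> nat) set" where
  "onto_tables A c = {f \<in> tables A c. {1..c} \<subseteq> {f x y | x y. True}}"

lemma onto_tablesD:
  assumes "f \<in> onto_tables A c"
  shows "f x y \<le> c" and "x \<notin> A \<Longrightarrow> f x y = 0" and "y \<notin> A \<Longrightarrow> f x y = 0"
    and "1 \<le> v \<Longrightarrow> v \<le> c \<Longrightarrow> \<exists>x\<in>A. \<exists>y\<in>A. f x y = v"
proof -
  show "f x y \<le> c" "x \<notin> A \<Longrightarrow> f x y = 0" "y \<notin> A \<Longrightarrow> f x y = 0"
    using assms unfolding onto_tables_def tables_def by blast+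
  assume v: "1 \<le> v" "v \<le> c"
  then have "v \<in> {f x y | x y. True}" using assms unfolding onto_tables_def by auto
  then obtain x y where "v = f x y" by blast
  then show "\<exists>x\<in>A. \<exists>y\<in>A. f x y = v"
    using assms v(1) unfolding onto_tables_def tables_def by fastforce
qed

text \<open>A table missing a nonzero value can be relabelled so that the missing value is
  \<open>Suc c\<close>, which makes it a table with bound \<open>c\<close>. Tables taking all values
  are never related to those, having too many values.\<close>

lemma card_table_classes_Suc:
  assumes fin: "finite A"
  shows "card (tables A (Suc c) // table_rel A)
    = card (tables A c // table_rel A) + card (onto_tables A (Suc c) // table_rel A)"
proof -
  let ?R = "table_rel A"
  have cover: "f \<in> tables A c \<or> f \<in> onto_tables A (Suc c) \<or> (\<exists>f'\<in>tables A c. (f, f') \<in> ?R)"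
    if f: "f \<in> tables A (Suc c)" for f
  proof (cases "f \<in> onto_tables A (Suc c)")
    case False
    then obtain v where v: "v \<in> {1..Suc c}" "\<And>x y. f x y \<noteq> v"
      using f unfolding onto_tables_def by blast
    define \<beta> where "\<beta> = transpose v (Suc c)"
    have b0: "\<beta> 0 = 0" using v(1) by (simp add: \<beta>_def transpose_def)
    have "\<beta> (f x y) \<le> c" for x y
    proof -
      have "f x y \<le> Suc c" using f by (simp add: tables_def)
      then show ?thesis using v(1) v(2)[of x y] by (auto simp: \<beta>_def transpose_def)
    qed
    moreover have "x \<in> A \<and> y \<in> A" if "\<beta> (f x y) \<noteq> 0" for x y
    proof -
      have "f x y \<noteq> 0" using that b0 by metis
      then show ?thesis using f unfolding tables_def by blast
    qed
    ultimately have "(\<lambda>x y. \<beta> (f x y)) \<in> tables A c" by (simp add: tables_def)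
    moreover have "(f, \<lambda>x y. \<beta> (f x y)) \<in> ?R"
    proof -
      have "id permutes A \<and> bij \<beta> \<and> \<beta> 0 = 0 \<and> (\<forall>x y. \<beta> (f (id x) (id y)) = \<beta> (f x y))"
        using b0 by (simp add: \<beta>_def)
      then show ?thesis unfolding table_rel_def by blast
    qed
    ultimately show ?thesis by blast
  qed simp
  have "tables A (Suc c) // ?R \<subseteq> tables A c // ?R \<union> onto_tables A (Suc c) // ?R"
  proof
    fix X assume "X \<in> tables A (Suc c) // ?R"
    then obtain f where f: "f \<in> tables A (Suc c)" "X = ?R `` {f}" by (elim quotientE)
    show "X \<in> tables A c // ?R \<union> onto_tables A (Suc c) // ?R"
      using cover[OF f(1)]
    proof (elim disjE bexE)
      fix f' assume f': "f' \<in> tables A c" "(f, f') \<in> ?R"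
      then have "X = ?R `` {f'}" using f(2) table_rel_image_eq_iff[of A f f'] by simp
      then show ?thesis using f'(1) by (simp add: quotientI)
    qed (simp_all add: f(2) quotientI)
  qed
  moreover have "E // ?R \<subseteq> tables A (Suc c) // ?R" if "E \<subseteq> tables A (Suc c)" for E
    using that by (auto simp: quotient_def)
  moreover have "tables A c \<subseteq> tables A (Suc c)" "onto_tables A (Suc c) \<subseteq> tables A (Suc c)"
    by (auto simp: tables_def onto_tables_def le_SucI)
  ultimately have un: "tables A (Suc c) // ?R = tables A c // ?R \<union> onto_tables A (Suc c) // ?R"
    by (simp add: subset_antisym)
  have unrel: "(f, g) \<notin> ?R" if f: "f \<in> tables A c" and g: "g \<in> onto_tables A (Suc c)" for f g
  proof
    assume "(f, g) \<in> ?R"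
    then obtain \<alpha> \<beta> where ab: "\<alpha> permutes A" "bij \<beta>" "\<beta> 0 = 0"
      "\<And>x y. g (\<alpha> x) (\<alpha> y) = \<beta> (f x y)" unfolding table_rel_def by blast
    \<comment> \<open>All values of \<open>g\<close> are images under \<beta> of values of
      \<open>f\<close>, which contradicts the sizes.\<close>
    have "{0..Suc c} \<subseteq> \<beta> ` {0..c}"
    proof
      fix v assume v: "v \<in> {0..Suc c}"
      show "v \<in> \<beta> ` {0..c}"
      proof (cases "v = 0")
        case True
        then show ?thesis using ab(3) by (metis atLeastAtMost_iff imageI le0)
      next
        case False
        then obtain x y where "g x y = v" using onto_tablesD(4)[OF g, of v] v by auto
        then have "v = \<beta> (f (inv_into UNIV \<alpha> x) (inv_into UNIV \<alpha> y))"
          using ab(4)[of "inv_into UNIV \<alpha> x" "inv_into UNIV \<alpha> y"] permutes_inverses(1)[OF ab(1)] by simp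
        then show ?thesis using f by (auto simp: tables_def)
      qed
    qed
    then have "card {0..Suc c} \<le> card (\<beta> ` {0..c})" by (intro card_mono) auto
    also have "\<dots> \<le> card {0..c}" by (rule card_image_le) simp
    finally show False by simp
  qed
  have "(tables A c // ?R) \<inter> (onto_tables A (Suc c) // ?R) = {}"
  proof (rule equals0I, elim IntE quotientE)
    fix X f g
    assume "f \<in> tables A c" "X = ?R `` {f}" "g \<in> onto_tables A (Suc c)" "X = ?R `` {g}"
    then show False using unrel[of f g] table_rel_image_eq_iff[of A f g] by simp
  qed
  moreover have "finite (tables A c // ?R)" "finite (onto_tables A (Suc c) // ?R)"
    using finite_tables[OF fin] unfolding quotient_def onto_tables_def by auto
  ultimately show ?thesis unfolding un by (rule card_Un_disjoint[rotated 2])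
qed

text \<open>With \<open>A\<close> kept, of size n - c - 1, lowering the bound from \<open>c\<close>
  to c - 1 lowers both arguments of \<open>NN\<close> by one.\<close>

lemma card_onto_table_classes:
  assumes "1 \<le> c" "c < n"
  shows "real (card (onto_tables {c<..<n} c // table_rel {c<..<n})) = NN n (Suc c) - NN (n - 1) c"
proof -
  obtain c' where c': "c = Suc c'" using assms(1) by (cases c) auto
  let ?A = "{c<..<n}"
  have "card ?A + Suc c = n" "card ?A + c = n - 1" using assms by auto
  then have "real (card (tables ?A c // table_rel ?A)) = NN n (Suc c)"
    "real (card (tables ?A c' // table_rel ?A)) = NN (n - 1) c"
    by (metis c' card_table_classes finite_greaterThanLessThan)+
  then show ?thesis
    using card_table_classes_Suc[of ?A c'] c' by simp
qed

lemma onto_tables_empty: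
  assumes "(card A)\<^sup>2 < c" "finite A"
  shows "onto_tables A c = {}"
proof (rule ccontr)
  assume "onto_tables A c \<noteq> {}"
  then obtain f where f: "f \<in> onto_tables A c" by blast
  have "{1..c} \<subseteq> (\<lambda>(x, y). f x y) ` (A \<times> A)"
    using onto_tablesD(4)[OF f] by force
  then have "card {1..c} \<le> card ((\<lambda>(x, y). f x y) ` (A \<times> A))"
    using assms(2) by (intro card_mono) auto
  also have "\<dots> \<le> card (A \<times> A)" by (rule card_image_le) (use assms(2) in simp)
  finally show False using assms(1) by (simp add: card_cartesian_product power2_eq_square)
qed

lemma sg_pow_2: "sg_pow f S 2 = {f x y | x y. x \<in> S \<and> y \<in> S}"
  by (simp add: numeral_2_eq_2)

lemma sg_pow_3: "sg_pow f S 3 = {f x y | x y. x \<in> sg_pow f S 2 \<and> y \<in> S}"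
  by (simp add: numeral_3_eq_3 numeral_2_eq_2)

text \<open>Values are at most \<open>c\<close> and hence outside \<open>{c<..<n}\<close>, so any
  product with a product is 0; both bracketings of a triple product vanish.\<close>

lemma onto_table_nilpotent:
  assumes c: "1 \<le> c" "c < n" and f: "f \<in> onto_tables {c<..<n} c"
  shows "f \<in> semigroup_tables n" "sg_pow f {0..<n} 2 = {0..c}" "nilpotent_deg3 n f"
proof -
  note D = onto_tablesD[OF f]
  have low: "f x y = 0" if "x \<le> c \<or> y \<le> c \<or> n \<le> x \<or> n \<le> y" for x y
    using that D(2)[of x y] D(3)[of y x] by auto
  show "f \<in> semigroup_tables n"
    unfolding semigroup_tables_def using D(1) low c
    by (auto simp: not_less intro: le_less_trans[OF D(1)])
  show pow2: "sg_pow f {0..<n} 2 = {0..c}"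
  proof
    show "sg_pow f {0..<n} 2 \<subseteq> {0..c}" using D(1) by (auto simp: sg_pow_2)
    show "{0..c} \<subseteq> sg_pow f {0..<n} 2"
    proof
      fix v assume v: "v \<in> {0..c}"
      show "v \<in> sg_pow f {0..<n} 2"
      proof (cases "v = 0")
        case True
        have "f 0 0 = 0" using low by simp
        then show ?thesis using True c unfolding sg_pow_2 by force
      next
        case False
        then obtain x y where "x \<in> {c<..<n}" "y \<in> {c<..<n}" "f x y = v" using D(4)[of v] v by auto
        then show ?thesis unfolding sg_pow_2 by force
      qed
    qed
  qed
  have "sg_pow f {0..<n} 3 = {0}"
    unfolding sg_pow_3 pow2 using low c by (auto intro!: exI[of _ 0])
  then show "nilpotent_deg3 n f" using c unfolding nilpotent_deg3_def pow2 by simp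
qed

section \<open>Isomorphism of semigroup tables and normal forms\<close>

lemma sg_iso_rel_image_sg_pow_2:
  assumes "bij_betw \<sigma> {0..<n} {0..<n}" "\<And>x y. x < n \<Longrightarrow> y < n \<Longrightarrow> \<sigma> (f x y) = g (\<sigma> x) (\<sigma> y)"
  shows "\<sigma> ` sg_pow f {0..<n} 2 = sg_pow g {0..<n} 2"
proof
  show "\<sigma> ` sg_pow f {0..<n} 2 \<subseteq> sg_pow g {0..<n} 2"
  proof
    fix v assume "v \<in> \<sigma> ` sg_pow f {0..<n} 2"
    then obtain x y where xy: "x < n" "y < n" "v = \<sigma> (f x y)" unfolding sg_pow_2 by auto
    then have "v = g (\<sigma> x) (\<sigma> y)" "\<sigma> x \<in> {0..<n}" "\<sigma> y \<in> {0..<n}"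
      using assms(2) bij_betwE[OF assms(1)] by auto
    then show "v \<in> sg_pow g {0..<n} 2" unfolding sg_pow_2 by blast
  qed
  show "sg_pow g {0..<n} 2 \<subseteq> \<sigma> ` sg_pow f {0..<n} 2"
  proof
    fix v assume "v \<in> sg_pow g {0..<n} 2"
    then obtain x y where xy: "x \<in> {0..<n}" "y \<in> {0..<n}" "v = g x y" unfolding sg_pow_2 by blast
    then have "x \<in> \<sigma> ` {0..<n}" "y \<in> \<sigma> ` {0..<n}"
      using bij_betw_imp_surj_on[OF assms(1)] by simp_all
    then obtain a b where "a \<in> {0..<n}" "b \<in> {0..<n}" "x = \<sigma> a" "y = \<sigma> b"
      by (elim imageE)
    then have "v = \<sigma> (f a b)" "f a b \<in> sg_pow f {0..<n} 2"
      using xy assms(2) unfolding sg_pow_2 by auto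
    then show "v \<in> \<sigma> ` sg_pow f {0..<n} 2" by blast
  qed
qed

lemma semigroup_tables_closed: "f \<in> semigroup_tables n \<Longrightarrow> x < n \<Longrightarrow> y < n \<Longrightarrow> f x y < n"
  by (simp add: semigroup_tables_def)

text \<open>The inverse of an isomorphism is available only on \<open>{0..<n}\<close>, so products
  of \<open>f\<close> must be known to stay there.\<close>

lemma sg_iso_rel_sym:
  assumes f: "f \<in> semigroup_tables n" and fg: "(f, g) \<in> sg_iso_rel n"
  shows "(g, f) \<in> sg_iso_rel n"
proof -
  obtain \<sigma> where s: "bij_betw \<sigma> {0..<n} {0..<n}" "\<And>x y. x < n \<Longrightarrow> y < n \<Longrightarrow> \<sigma> (f x y) = g (\<sigma> x) (\<sigma> y)"
    using fg unfolding sg_iso_rel_def by blast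
  let ?t = "inv_into {0..<n} \<sigma>"
  have "?t (g x y) = f (?t x) (?t y)" if "x < n" "y < n" for x y
  proof -
    have t: "?t z < n" "\<sigma> (?t z) = z" if "z < n" for z
      using that bij_betwE[OF bij_betw_inv_into[OF s(1)]] bij_betw_inv_into_right[OF s(1)] by auto
    have "f (?t x) (?t y) < n" using semigroup_tables_closed[OF f] t(1) that by simp
    then show ?thesis
      using s(2)[OF t(1) t(1), OF that] t(2) that bij_betw_inv_into_left[OF s(1), of "f (?t x) (?t y)"] by simp
  qed
  then show ?thesis
    unfolding sg_iso_rel_def using bij_betw_inv_into[OF s(1)] by blast
qed

lemma sg_iso_rel_refl: "(f, f) \<in> sg_iso_rel n"
  unfolding sg_iso_rel_def by (auto intro!: exI[of _ id])

lemma sg_iso_rel_trans: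
  assumes "(f, g) \<in> sg_iso_rel n" "(g, h) \<in> sg_iso_rel n"
  shows "(f, h) \<in> sg_iso_rel n"
proof -
  obtain \<sigma> where s: "bij_betw \<sigma> {0..<n} {0..<n}" "\<And>x y. x < n \<Longrightarrow> y < n \<Longrightarrow> \<sigma> (f x y) = g (\<sigma> x) (\<sigma> y)"
    using assms(1) unfolding sg_iso_rel_def by blast
  obtain \<tau> where t: "bij_betw \<tau> {0..<n} {0..<n}" "\<And>x y. x < n \<Longrightarrow> y < n \<Longrightarrow> \<tau> (g x y) = h (\<tau> x) (\<tau> y)"
    using assms(2) unfolding sg_iso_rel_def by blast
  have "(\<tau> \<circ> \<sigma>) (f x y) = h ((\<tau> \<circ> \<sigma>) x) ((\<tau> \<circ> \<sigma>) y)" if "x < n" "y < n" for x y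
    using s(2)[OF that] t(2)[of "\<sigma> x" "\<sigma> y"] bij_betwE[OF s(1)] that by simp
  then show ?thesis
    unfolding sg_iso_rel_def using bij_betw_trans[OF s(1) t(1)] by blast
qed

lemma sg_iso_rel_image_eq_iff:
  assumes "f \<in> semigroup_tables n" "g \<in> semigroup_tables n"
  shows "sg_iso_rel n `` {f} = sg_iso_rel n `` {g} \<longleftrightarrow> (f, g) \<in> sg_iso_rel n"
proof
  assume "sg_iso_rel n `` {f} = sg_iso_rel n `` {g}"
  then show "(f, g) \<in> sg_iso_rel n" using sg_iso_rel_refl[of g n] by blast
next
  assume fg: "(f, g) \<in> sg_iso_rel n"
  then have gf: "(g, f) \<in> sg_iso_rel n" by (rule sg_iso_rel_sym[OF assms(1)])
  show "sg_iso_rel n `` {f} = sg_iso_rel n `` {g}"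
    using sg_iso_rel_trans[OF fg] sg_iso_rel_trans[OF gf] by blast
qed

text \<open>An isomorphism preserves the set of products \<open>{0..c}\<close> and therefore its
  complement, so it splits into \<beta> and \<alpha>. Conversely \<alpha> and \<beta> have disjoint
  supports, and their composition is an isomorphism.\<close>

lemma onto_tables_iso_iff_table_rel:
  assumes c: "1 \<le> c" "c < n" and f: "f \<in> onto_tables {c<..<n} c" and g: "g \<in> onto_tables {c<..<n} c"
  shows "(f, g) \<in> sg_iso_rel n \<longleftrightarrow> (f, g) \<in> table_rel {c<..<n}"
proof
  let ?A = "{c<..<n}"
  note Df = onto_tablesD[OF f] and Dg = onto_tablesD[OF g]
  have ft: "f \<in> tables ?A c" "g \<in> tables ?A c" using f g by (auto simp: onto_tables_def)
  {
    assume "(f, g) \<in> table_rel ?A"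
    then obtain \<alpha> \<beta> where ab: "\<alpha> permutes ?A" "\<beta> permutes {1..c}" "\<And>x y. g (\<alpha> x) (\<alpha> y) = \<beta> (f x y)"
      using table_rel_iff_permutes[OF ft] by blast
    have b0: "\<beta> 0 = 0" using permutes_not_in[OF ab(2)] by simp
    have sA: "(\<alpha> \<circ> \<beta>) x = \<alpha> x" if "x \<in> ?A" for x
      using permutes_not_in[OF ab(2), of x] that by simp
    have sC: "(\<alpha> \<circ> \<beta>) x = \<beta> x" "\<beta> x \<le> c" if "x \<le> c" for x
    proof -
      show "\<beta> x \<le> c" using permutes_in_image[OF ab(2), of x] b0 that by (cases "x = 0") auto
      then show "(\<alpha> \<circ> \<beta>) x = \<beta> x" using permutes_not_in[OF ab(1), of "\<beta> x"] by simp
    qed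
    have "\<alpha> \<circ> \<beta> permutes {0..<n}"
      using c by (intro permutes_compose permutes_subset[OF ab(1)] permutes_subset[OF ab(2)]) auto
    moreover have "(\<alpha> \<circ> \<beta>) (f x y) = g ((\<alpha> \<circ> \<beta>) x) ((\<alpha> \<circ> \<beta>) y)" if "x < n" "y < n" for x y
    proof (cases "x \<in> ?A \<and> y \<in> ?A")
      case True
      then show ?thesis using sA ab(3) sC(1)[OF Df(1)] by simp
    next
      case False
      then have "x \<le> c \<or> y \<le> c" using that by auto
      then show ?thesis
      proof
        assume x: "x \<le> c"
        then show ?thesis using sC[OF x] sC[of 0] Df(2)[of x y] Dg(2)[of "\<beta> x"] b0 by simp
      next
        assume y: "y \<le> c"
        then show ?thesis using sC[OF y] sC[of 0] Df(3)[of y x] Dg(3)[of "\<beta> y"] b0 by simp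
      qed
    qed
    ultimately show "(f, g) \<in> sg_iso_rel n"
      unfolding sg_iso_rel_def using permutes_imp_bij by blast
  }
  assume "(f, g) \<in> sg_iso_rel n"
  then obtain \<sigma> where s: "bij_betw \<sigma> {0..<n} {0..<n}" "\<And>x y. x < n \<Longrightarrow> y < n \<Longrightarrow> \<sigma> (f x y) = g (\<sigma> x) (\<sigma> y)"
    unfolding sg_iso_rel_def by blast
  have img: "\<sigma> ` {0..c} = {0..c}"
    using sg_iso_rel_image_sg_pow_2[of \<sigma> n f g, OF s] onto_table_nilpotent(2)[OF c f] onto_table_nilpotent(2)[OF c g]
    by simp
  then have bijC: "bij_betw \<sigma> {0..c} {0..c}"
    using s(1) c by (intro bij_betw_subset[OF s(1)]) auto
  have A: "?A = {0..<n} - {0..c}" by auto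
  have bijA: "bij_betw \<sigma> ?A ?A"
    unfolding A using c by (intro bij_betw_DiffI s(1) bijC) auto
  define \<alpha> where "\<alpha> = restrict_id \<sigma> ?A"
  define \<beta> where "\<beta> = restrict_id \<sigma> {0..c}"
  have ab: "\<alpha> permutes ?A" "\<beta> permutes {0..c}"
    unfolding \<alpha>_def \<beta>_def using bijA bijC by (auto intro: permutes_restrict_id)
  \<comment> \<open>The zero is preserved: the image of 0 lies outside \<open>?A\<close>, so its
    square under \<open>g\<close> is 0, while it is also the image of
    \<open>f 0 0 = 0\<close>.\<close>
  have "\<sigma> 0 \<le> c" using img by auto
  then have "g (\<sigma> 0) (\<sigma> 0) = 0" using Dg(2)[of "\<sigma> 0"] by simp
  moreover have "f 0 0 = 0" using Df(2) by simp
  ultimately have s0: "\<sigma> 0 = 0" using s(2)[of 0 0] c by simp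
  then have b0: "\<beta> 0 = 0" by (simp add: \<beta>_def restrict_id_def)
  have "g (\<alpha> x) (\<alpha> y) = \<beta> (f x y)" for x y
  proof (cases "x \<in> ?A \<and> y \<in> ?A")
    case True
    then show ?thesis using s(2)[of x y] Df(1)[of x y] by (simp add: \<alpha>_def \<beta>_def restrict_id_def)
  next
    case False
    then have "f x y = 0" "g (\<alpha> x) (\<alpha> y) = 0"
      using Df(2)[of x y] Df(3)[of y x] Dg(2)[of "\<alpha> x" "\<alpha> y"] Dg(3)[of "\<alpha> y" "\<alpha> x"] permutes_in_image[OF ab(1)]
      by blast+
    then show ?thesis using b0 by simp
  qed
  then show "(f, g) \<in> table_rel ?A"
    unfolding table_rel_def using ab(1) permutes_bij[OF ab(2)] b0 by blast
qed

text \<open>The elements are renumbered: the unique triple product becomes 0, the other products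
  \<open>{1..c}\<close>, the rest \<open>{c<..<n}\<close>; the multiplication is transported
  along.\<close>

lemma nilpotent_normal_form:
  assumes f: "f \<in> semigroup_tables n" and nil: "nilpotent_deg3 n f"
  shows "\<exists>c g. 1 \<le> c \<and> c < n \<and> g \<in> onto_tables {c<..<n} c \<and> (f, g) \<in> sg_iso_rel n"
proof -
  let ?S = "{0..<n}"
  define P where "P = sg_pow f ?S 2"
  have closed: "f x y < n" if "x < n" "y < n" for x y
    using semigroup_tables_closed[OF f] that .
  have assoc: "f (f x y) z = f x (f y z)" if "x < n" "y < n" "z < n" for x y z
    using f that by (simp add: semigroup_tables_def)
  have P: "v \<in> P \<longleftrightarrow> (\<exists>x y. x < n \<and> y < n \<and> v = f x y)" for v
    by (auto simp: P_def sg_pow_2)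
  have PS: "P \<subseteq> ?S" using P closed by auto
  then have finP: "finite P" using finite_subset by blast
  obtain z where z: "sg_pow f ?S 3 = {z}"
    using nil unfolding nilpotent_deg3_def by (meson card_1_singletonE)
  define c where "c = card P - 1"
  have cardP: "card P = Suc c" "1 \<le> c"
    using nil unfolding nilpotent_deg3_def P_def[symmetric] by (auto simp: c_def)
  have left: "f x y = z" if "x \<in> P" "y < n" for x y
  proof -
    have "f x y \<in> sg_pow f ?S 3" unfolding sg_pow_3 P_def[symmetric] using that by auto
    then show ?thesis using z by simp
  qed
  \<comment> \<open>\<open>sg_pow\<close> brackets to the left, so only products with a product as
    left factor are triple products by definition; associativity carries this to the right
    factor.\<close>
  have right: "f y x = z" if x: "x \<in> P" and y: "y < n" for x y
  proof -
    obtain a b where ab: "a < n" "b < n" "x = f a b" using x unfolding P by blast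
    have "f y x = f (f y a) b" using assoc[OF y ab(1,2)] ab(3) by simp
    moreover have "f y a \<in> P" unfolding P using y ab(1) by blast
    ultimately show ?thesis using left ab(2) by simp
  qed
  have zP: "z \<in> P"
  proof -
    have "z \<in> sg_pow f ?S 3" using z by simp
    then obtain x y where "x \<in> P" "y < n" "z = f x y"
      unfolding sg_pow_3 P_def[symmetric] by auto
    moreover then have "x < n" using PS by auto
    ultimately show ?thesis unfolding P by blast
  qed
  have cardS: "card (?S - P) = n - Suc c" "Suc c \<le> n"
    using cardP(1) PS finP card_mono[OF _ PS] by (auto simp: card_Diff_subset)
  obtain h where h: "bij_betw h (P - {z}) {1..c}"
    using finite_same_card_bij[of "P - {z}" "{1..c}"] finP zP cardP by auto
  obtain k where k: "bij_betw k (?S - P) {c<..<n}"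
    using finite_same_card_bij[of "?S - P" "{c<..<n}"] cardS by auto
  define \<sigma> where "\<sigma> x = (if x = z then 0 else if x \<in> P then h x else k x)" for x
  have "bij_betw \<sigma> {z} {0}" by (simp add: \<sigma>_def bij_betw_def)
  moreover have "bij_betw \<sigma> (P - {z}) {1..c}"
    using h by (subst bij_betw_cong[of _ _ h]) (auto simp: \<sigma>_def)
  ultimately have "bij_betw \<sigma> ({z} \<union> (P - {z})) ({0} \<union> {1..c})" by (rule bij_betw_combine) auto
  moreover have "{z} \<union> (P - {z}) = P" "{0} \<union> {1..c} = {0..c}" using zP by auto
  ultimately have bijP: "bij_betw \<sigma> P {0..c}" by simp
  have bijA: "bij_betw \<sigma> (?S - P) {c<..<n}"
    using k zP by (subst bij_betw_cong[of _ _ k]) (auto simp: \<sigma>_def)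
  have "bij_betw \<sigma> (P \<union> (?S - P)) ({0..c} \<union> {c<..<n})"
    using bijP bijA by (rule bij_betw_combine) auto
  moreover have "P \<union> (?S - P) = ?S" "{0..c} \<union> {c<..<n} = ?S" using PS cardS(2) by auto
  ultimately have bij: "bij_betw \<sigma> ?S ?S" by simp
  let ?t = "inv_into ?S \<sigma>"
  have t: "?t x < n" "\<sigma> (?t x) = x" if "x < n" for x
    using that bij_betwE[OF bij_betw_inv_into[OF bij]] bij_betw_inv_into_right[OF bij] by auto
  have ts: "?t (\<sigma> x) = x" "\<sigma> x < n" if "x < n" for x
    using that bij_betw_inv_into_left[OF bij] bij_betwE[OF bij] by auto
  define g where "g x y = (if x < n \<and> y < n then \<sigma> (f (?t x) (?t y)) else 0)" for x y
  have iso: "\<sigma> (f x y) = g (\<sigma> x) (\<sigma> y)" if "x < n" "y < n" for x y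
    using that ts by (simp add: g_def)
  have \<sigma>z: "\<sigma> z = 0" by (simp add: \<sigma>_def)
  have inA: "x \<in> {c<..<n}" if "x < n" "?t x \<notin> P" for x
  proof -
    have "\<sigma> (?t x) \<in> {c<..<n}" using bij_betwE[OF bijA] t(1)[OF that(1)] that(2) by auto
    then show ?thesis using t(2)[OF that(1)] by simp
  qed
  have "g x y \<le> c" for x y
  proof (cases "x < n \<and> y < n")
    case True
    then have "f (?t x) (?t y) \<in> P" unfolding P using t(1) by blast
    then show ?thesis using True bij_betwE[OF bijP] by (auto simp: g_def)
  qed (auto simp: g_def)
  moreover have "x \<in> {c<..<n} \<and> y \<in> {c<..<n}" if "g x y \<noteq> 0" for x y
  proof -
    have xy: "x < n" "y < n" "\<sigma> (f (?t x) (?t y)) \<noteq> 0"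
      using that by (auto simp: g_def split: if_splits)
    then have "?t x \<notin> P" "?t y \<notin> P" using left right t(1) \<sigma>z by metis+
    then show ?thesis using inA xy by blast
  qed
  ultimately have "g \<in> tables {c<..<n} c" by (simp add: tables_def)
  moreover have "{1..c} \<subseteq> {g x y | x y. True}"
  proof
    fix v assume "v \<in> {1..c}"
    then have "v \<in> \<sigma> ` P" using bij_betw_imp_surj_on[OF bijP] by simp
    then obtain p where p: "p \<in> P" "v = \<sigma> p" by blast
    then obtain a b where "a < n" "b < n" "v = \<sigma> (f a b)" unfolding P by blast
    then have "v = g (\<sigma> a) (\<sigma> b)" using iso by simp
    then show "v \<in> {g x y | x y. True}" by blast
  qed
  ultimately have "g \<in> onto_tables {c<..<n} c" by (simp add: onto_tables_def)
  moreover have "(f, g) \<in> sg_iso_rel n"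
    unfolding sg_iso_rel_def using bij iso by blast
  moreover have "c < n" using cardS(2) by simp
  ultimately show ?thesis using cardP(2) by blast
qed

text \<open>The number of products, c + 1, is an isomorphism invariant, so the classes split
  disjointly by \<open>c\<close>; within one \<open>c\<close>, isomorphism is
  \<open>table_rel\<close>.\<close>

lemma num_nil3_eq_sum: "num_nil3 n = (\<Sum>c\<in>{1..<n}. card (onto_tables {c<..<n} c // table_rel {c<..<n}))"
proof -
  let ?N = "{f \<in> semigroup_tables n. nilpotent_deg3 n f}"
  let ?Y = "\<lambda>c. onto_tables {c<..<n} c"
  let ?R = "sg_iso_rel n"
  have Y: "?Y c \<subseteq> ?N" if "c \<in> {1..<n}" for c
    using onto_table_nilpotent[of c n] that by auto
  have "?N // ?R = (\<Union>c\<in>{1..<n}. ?Y c // ?R)"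
  proof
    show "?N // ?R \<subseteq> (\<Union>c\<in>{1..<n}. ?Y c // ?R)"
    proof
      fix X assume "X \<in> ?N // ?R"
      then obtain f where f: "f \<in> ?N" "X = ?R `` {f}" by (auto simp: quotient_def)
      then obtain c g where c: "1 \<le> c" "c < n" and g: "g \<in> ?Y c" "(f, g) \<in> ?R"
        using nilpotent_normal_form by blast
      have "X = ?R `` {g}"
        using f g c onto_table_nilpotent(1)[of c n g] sg_iso_rel_image_eq_iff[of f n g] by simp
      then have "X \<in> ?Y c // ?R" using g(1) by (auto simp: quotient_def)
      then show "X \<in> (\<Union>c\<in>{1..<n}. ?Y c // ?R)" using c by auto
    qed
    show "(\<Union>c\<in>{1..<n}. ?Y c // ?R) \<subseteq> ?N // ?R"
      using Y unfolding quotient_def by blast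
  qed
  then have "num_nil3 n = card (\<Union>c\<in>{1..<n}. ?Y c // ?R)" by (simp add: num_nil3_def)
  also have "\<dots> = (\<Sum>c\<in>{1..<n}. card (?Y c // ?R))"
  proof (rule card_UN_disjoint)
    show "\<forall>c\<in>{1..<n}. finite (?Y c // ?R)"
      using finite_tables by (auto simp: quotient_def onto_tables_def)
    have "c = c'" if c: "c \<in> {1..<n}" "c' \<in> {1..<n}" and X: "X \<in> ?Y c // ?R" "X \<in> ?Y c' // ?R" for c c' X
    proof -
      obtain f g where fg: "f \<in> ?Y c" "g \<in> ?Y c'" "?R `` {f} = ?R `` {g}"
        using X by (auto simp: quotient_def)
      have f: "f \<in> semigroup_tables n" "sg_pow f {0..<n} 2 = {0..c}"
        and g: "g \<in> semigroup_tables n" "sg_pow g {0..<n} 2 = {0..c'}"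
        using onto_table_nilpotent[of c n f] onto_table_nilpotent[of c' n g] fg c by auto
      then have "(f, g) \<in> ?R" using fg(3) sg_iso_rel_image_eq_iff[OF f(1) g(1)] by simp
      then obtain \<sigma> where s: "bij_betw \<sigma> {0..<n} {0..<n}" "\<And>x y. x < n \<Longrightarrow> y < n \<Longrightarrow> \<sigma> (f x y) = g (\<sigma> x) (\<sigma> y)"
        unfolding sg_iso_rel_def by blast
      have "\<sigma> ` {0..c} = {0..c'}"
        using sg_iso_rel_image_sg_pow_2[of \<sigma> n f g, OF s] f(2) g(2) by simp
      moreover have "inj_on \<sigma> {0..c}"
        using bij_betw_imp_inj_on[OF s(1)] by (rule inj_on_subset) (use c in auto)
      ultimately have "card {0..c} = card {0..c'}" by (metis card_image)
      then show ?thesis by simp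
    qed
    then show "\<forall>c\<in>{1..<n}. \<forall>c'\<in>{1..<n}. c \<noteq> c' \<longrightarrow> ?Y c // ?R \<inter> ?Y c' // ?R = {}" by blast
  qed simp
  also have "\<dots> = (\<Sum>c\<in>{1..<n}. card (?Y c // table_rel {c<..<n}))"
  proof (rule sum.cong[OF refl], rule card_quotient_cong)
    fix c f g assume c: "c \<in> {1..<n}" and fg: "f \<in> ?Y c" "g \<in> ?Y c"
    then show "?R `` {f} = ?R `` {g} \<longleftrightarrow> table_rel {c<..<n} `` {f} = table_rel {c<..<n} `` {g}"
      using sg_iso_rel_image_eq_iff[of f n g] onto_table_nilpotent(1)[of c n]
        onto_tables_iso_iff_table_rel[of c n f g] table_rel_image_eq_iff[of "{c<..<n}" f g] by auto
  qed
  finally show ?thesis .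
qed

section \<open>The range of summation\<close>

text \<open>With r = n - m the left side says that the root is at most r + 1/2. Squaring gives n -
  3/4 \<le> r^2 + r + 1/4, that is m - 1 \<le> r^2; the constants 1/2 and 3/4 come from completing
  this square.\<close>

lemma le_floor_bound_iff:
  assumes "m \<le> n" "1 \<le> m"
  shows "m \<le> nat \<lfloor>real n + 1/2 - sqrt (real n - 3/4)\<rfloor> \<longleftrightarrow> m - 1 \<le> (n - m)\<^sup>2"
proof -
  define r where "r = real n - real m"
  have r: "0 \<le> r" "real (n - m) = r" using assms by (auto simp: r_def of_nat_diff)
  have "m \<le> nat \<lfloor>real n + 1/2 - sqrt (real n - 3/4)\<rfloor> \<longleftrightarrow> int m \<le> \<lfloor>real n + 1/2 - sqrt (real n - 3/4)\<rfloor>"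
    using assms(2) by linarith
  also have "\<dots> \<longleftrightarrow> sqrt (real n - 3/4) \<le> r + 1/2"
    unfolding le_floor_iff r_def by (simp add: algebra_simps)
  also have "\<dots> \<longleftrightarrow> real n - 3/4 \<le> (r + 1/2)\<^sup>2"
    using r(1) by (metis abs_of_nonneg add_nonneg_nonneg half_gt_zero_iff less_eq_real_def real_sqrt_abs real_sqrt_le_iff zero_less_one)
  also have "\<dots> \<longleftrightarrow> real m - 1 \<le> r\<^sup>2"
    by (simp add: r_def power2_eq_square algebra_simps)
  also have "\<dots> \<longleftrightarrow> real (m - 1) \<le> real ((n - m)\<^sup>2)"
    using assms(2) r(2) by (simp add: of_nat_diff)
  finally show ?thesis by (simp only: of_nat_le_iff)
qed

theorem theorem2p2:
  fixes n :: nat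
  assumes "1 \<le> n"
  shows "real (num_nil3 n) =
    (\<Sum>m\<in>{2..nat \<lfloor>real n + 1/2 - sqrt (real n - 3/4)\<rfloor>}.
        NN n m - NN (n - 1) (m - 1))"
proof -
  let ?a = "nat \<lfloor>real n + 1/2 - sqrt (real n - 3/4)\<rfloor>"
  let ?d = "\<lambda>m. NN n m - NN (n - 1) (m - 1)"
  \<comment> \<open>From n \<ge> 1 the radicand is at least 1/4, so the root is at least 1/2 and the
    upper limit does not exceed \<open>n\<close>.\<close>
  have "sqrt ((1/2)\<^sup>2) \<le> sqrt (real n - 3/4)"
    using assms by (intro real_sqrt_le_mono) (simp add: power2_eq_square)
  then have a: "?a \<le> n" by (simp add: nat_le_iff floor_le_iff)
  have d: "?d (Suc c) = real (card (onto_tables {c<..<n} c // table_rel {c<..<n}))"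
    if "c \<in> {1..<n}" for c
    using card_onto_table_classes[of c n] that by simp
  have "real (num_nil3 n) = (\<Sum>c\<in>{1..<n}. ?d (Suc c))"
    unfolding num_nil3_eq_sum of_nat_sum by (rule sum.cong[OF refl]) (rule d[symmetric])
  also have "\<dots> = (\<Sum>m\<in>{2..n}. ?d m)"
    by (rule sum.reindex_bij_witness[of _ "\<lambda>m. m - 1" Suc]) auto
  also have "\<dots> = (\<Sum>m\<in>{2..?a}. ?d m)"
  proof (rule sum.mono_neutral_right)
    \<comment> \<open>Beyond the limit there are more nonzero products to hit than pairs from
      \<open>A\<close>, so the difference counts classes of an empty set of tables.\<close>
    show "\<forall>m\<in>{2..n} - {2..?a}. ?d m = 0"
    proof
      fix m assume m: "m \<in> {2..n} - {2..?a}"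
      then have "\<not> m - 1 \<le> (n - m)\<^sup>2" using le_floor_bound_iff[of m n] by auto
      moreover have "card {m - 1<..<n} = n - m" using m by auto
      ultimately have "onto_tables {m - 1<..<n} (m - 1) = {}" by (intro onto_tables_empty) auto
      moreover have "m - 1 \<in> {1..<n}" "Suc (m - 1) = m" using m by auto
      ultimately show "?d m = 0" using d[of "m - 1"] by simp
    qed
  qed (use a in auto)
  finally show ?thesis .
qed

end
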